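(* Let $d\ge1$, let $\rho\in(0,1)^d$ with $|\rho|<1$, and let $N$ be a positive integer. For $x,y\in\mathbb{Z}_N^{d+1}$ and $0\le r\le 1$, the Poisson kernel $\Phi_r(\mathsf{K}_{\rho,N};x,y)=\sum_{n=0}^N\mathsf{P}_n(\mathsf{K}_{\rho,N};x,y)\,r^n$ of the Krawtchouck polynomials satisfies $$\Phi_r(\mathsf{K}_{\rho,N};x,y)=\sum_{k=0}^N\frac{(-1)^k}{(-N)_k}\,\mathcal{F}_k(x,y;\rho)\,r^k(1-r)^{N-k}.$$ In particular, $\Phi_r(\mathsf{K}_{\rho,N};x,y)$ is nonnegative for all $x,y\in\mathbb{Z}_N^{d+1}$ and $0\le r\le1$.
   Context: Notation: $(a)_k=a(a+1)\cdots(a+k-1)$; for vectors, $|\cdot|$ is the sum of the components, $\gamma!=\prod_i\gamma_i!$, $(-x)_\gamma=\prod_i(-x_i)_{\gamma_i}$. $\mathbb{Z}_N^{d+1}=\{\alpha\in\mathbb{N}_0^{d+1}:|\alpha|=N\}$. Put $\boldsymbol\rho=(\rho_1,\ldots,\rho_d,1-|\rho|)$ and $\boldsymbol\rho^\gamma=\prod_{i=1}^{d+1}\boldsymbol\rho_i^{\gamma_i}$. Convention $0^0=1$. Krawtchouck inner product of functions on $\mathbb{Z}_N^{d+1}$: $$\langle f,g\rangle_{\mathsf{K}_{\rho,N}}=N!\sum_{\alpha\in\mathbb{Z}_N^{d+1}}f(\alpha)g(\alpha)\frac{\boldsymbol\rho^\alpha}{\alpha!},$$ normalized so that $\langle1,1\rangle=1$.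 A polynomial on $\mathbb{Z}_N^{d+1}$ of degree at most $n$ is the restriction of a polynomial of total degree at most $n$ in the first $d$ coordinates. For $0\le n\le N$, $\mathcal{V}_n^d(\mathsf{K}_{\rho,N})$ is the space of polynomials of degree at most $n$ on $\mathbb{Z}_N^{d+1}$ orthogonal to all polynomials of degree at most $n-1$. $\mathsf{P}_n(\mathsf{K}_{\rho,N};x,y)$ is the reproducing kernel of $\mathcal{V}_n^d(\mathsf{K}_{\rho,N})$: it lies in $\mathcal{V}_n^d(\mathsf{K}_{\rho,N})$ in each variable and $\langle\mathsf{P}_n(\mathsf{K}_{\rho,N};x,\cdot),Q\rangle_{\mathsf{K}_{\rho,N}}=Q(x)$ for all $Q\in\mathcal{V}_n^d(\mathsf{K}_{\rho,N})$. For $x,y\in\mathbb{Z}_N^{d+1}$, $\mathcal{F}_0(x,y;\rho)=1$ and $$\mathcal{F}_k(x,y;\rho)=\sum_{\gamma\in\mathbb{N}_0^{d+1},\,|\gamma|=k}\frac{(-x)_\gamma(-y)_\gamma}{\boldsymbol\rho^\gamma\,\gamma!}.$$ *)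

theory Defs
  imports Complex_Main
begin

text \<open>
  Vectors with \<open>m\<close> components are functions on \<open>nat\<close> of which only the values at \<open>0, \<dots>, m - 1\<close>
  matter; multi-indices are required to vanish from \<open>m\<close> on, so that each is represented by exactly
  one function. In particular \<open>multi_index (Suc d) N\<close> is \<open>\<int>\<^sub>N\<close> in dimension \<open>d + 1\<close>, with the
  first \<open>d\<close> coordinates at positions \<open>0, \<dots>, d - 1\<close> and the last one at position \<open>d\<close>.
\<close>

definition multi_index :: "nat \<Rightarrow> nat \<Rightarrow> (nat \<Rightarrow> nat) set" where
  "multi_index m k = {\<alpha>. (\<forall>i\<ge>m. \<alpha> i = 0) \<and> (\<Sum>i<m. \<alpha> i) = k}"

definition full_rho :: "nat \<Rightarrow> (nat \<Rightarrow> real) \<Rightarrow> nat \<Rightarrow> real" where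
  "full_rho d \<rho> i = (if i < d then \<rho> i else 1 - (\<Sum>j<d. \<rho> j))"

definition rho_power :: "nat \<Rightarrow> (nat \<Rightarrow> real) \<Rightarrow> (nat \<Rightarrow> nat) \<Rightarrow> real" where
  "rho_power d \<rho> \<gamma> = (\<Prod>i\<le>d. full_rho d \<rho> i ^ \<gamma> i)"

definition multi_fact :: "nat \<Rightarrow> (nat \<Rightarrow> nat) \<Rightarrow> real" where
  "multi_fact d \<gamma> = (\<Prod>i\<le>d. fact (\<gamma> i))"

definition neg_pochhammer :: "nat \<Rightarrow> (nat \<Rightarrow> nat) \<Rightarrow> (nat \<Rightarrow> nat) \<Rightarrow> real" where
  "neg_pochhammer d x \<gamma> = (\<Prod>i\<le>d. pochhammer (- real (x i)) (\<gamma> i))"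

definition krawtchouk_inner ::
    "nat \<Rightarrow> (nat \<Rightarrow> real) \<Rightarrow> nat \<Rightarrow> ((nat \<Rightarrow> nat) \<Rightarrow> real) \<Rightarrow> ((nat \<Rightarrow> nat) \<Rightarrow> real) \<Rightarrow> real" where
  "krawtchouk_inner d \<rho> N f g =
     fact N * (\<Sum>\<alpha>\<in>multi_index (Suc d) N. f \<alpha> * g \<alpha> * (rho_power d \<rho> \<alpha> / multi_fact d \<alpha>))"

text \<open>
  Functions on \<open>multi_index (Suc d) N\<close> are total functions whose values elsewhere are irrelevant:
  the sets of functions below only constrain the values on \<open>multi_index (Suc d) N\<close>.
  The coefficients \<open>c\<close> are those of a polynomial in \<open>d\<close> variables of total degree at most \<open>n\<close>.
\<close>

definition poly_space :: "nat \<Rightarrow> nat \<Rightarrow> nat \<Rightarrow> ((nat \<Rightarrow> nat) \<Rightarrow> real) set" where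
  "poly_space d N n =
     {f. \<exists>c :: (nat \<Rightarrow> nat) \<Rightarrow> real. \<forall>\<alpha>\<in>multi_index (Suc d) N.
           f \<alpha> = (\<Sum>k\<le>n. \<Sum>\<beta>\<in>multi_index d k. c \<beta> * (\<Prod>i<d. real (\<alpha> i) ^ \<beta> i))}"

text \<open>
  Orthogonality to degree at most \<open>n - 1\<close> is stated with \<open>m < n\<close>, so that it is no condition
  for \<open>n = 0\<close>.
\<close>

definition krawtchouk_space ::
    "nat \<Rightarrow> (nat \<Rightarrow> real) \<Rightarrow> nat \<Rightarrow> nat \<Rightarrow> ((nat \<Rightarrow> nat) \<Rightarrow> real) set" where
  "krawtchouk_space d \<rho> N n =
     {f \<in> poly_space d N n. \<forall>m<n. \<forall>g\<in>poly_space d N m. krawtchouk_inner d \<rho> N f g = 0}"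

definition is_reproducing_kernel ::
    "nat \<Rightarrow> (nat \<Rightarrow> real) \<Rightarrow> nat \<Rightarrow> nat \<Rightarrow> ((nat \<Rightarrow> nat) \<Rightarrow> (nat \<Rightarrow> nat) \<Rightarrow> real) \<Rightarrow> bool" where
  "is_reproducing_kernel d \<rho> N n P \<longleftrightarrow>
     (\<forall>x\<in>multi_index (Suc d) N. (\<lambda>y. P x y) \<in> krawtchouk_space d \<rho> N n) \<and>
     (\<forall>y\<in>multi_index (Suc d) N. (\<lambda>x. P x y) \<in> krawtchouk_space d \<rho> N n) \<and>
     (\<forall>x\<in>multi_index (Suc d) N. \<forall>Q\<in>krawtchouk_space d \<rho> N n.
        krawtchouk_inner d \<rho> N (P x) Q = Q x)"

text \<open>
  The kernel is extended by zero off \<open>multi_index (Suc d) N\<close>, which makes it unique as a total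
  function; existence and uniqueness are proved below.
\<close>

definition krawtchouk_kernel ::
    "nat \<Rightarrow> (nat \<Rightarrow> real) \<Rightarrow> nat \<Rightarrow> nat \<Rightarrow> (nat \<Rightarrow> nat) \<Rightarrow> (nat \<Rightarrow> nat) \<Rightarrow> real" where
  "krawtchouk_kernel d \<rho> N n =
     (THE P. is_reproducing_kernel d \<rho> N n P \<and>
        (\<forall>x y. x \<notin> multi_index (Suc d) N \<or> y \<notin> multi_index (Suc d) N \<longrightarrow> P x y = 0))"

definition poisson_kernel ::
    "nat \<Rightarrow> (nat \<Rightarrow> real) \<Rightarrow> nat \<Rightarrow> real \<Rightarrow> (nat \<Rightarrow> nat) \<Rightarrow> (nat \<Rightarrow> nat) \<Rightarrow> real" where
  "poisson_kernel d \<rho> N r x y = (\<Sum>n\<le>N. krawtchouk_kernel d \<rho> N n x y * r ^ n)"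

text \<open>For \<open>k = 0\<close> the only multi-index is zero and the value is \<open>1\<close>.\<close>

definition krawtchouk_F ::
    "nat \<Rightarrow> (nat \<Rightarrow> real) \<Rightarrow> nat \<Rightarrow> (nat \<Rightarrow> nat) \<Rightarrow> (nat \<Rightarrow> nat) \<Rightarrow> real" where
  "krawtchouk_F d \<rho> k x y =
     (\<Sum>\<gamma>\<in>multi_index (Suc d) k.
        neg_pochhammer d x \<gamma> * neg_pochhammer d y \<gamma> / (rho_power d \<rho> \<gamma> * multi_fact d \<gamma>))"


lemma finite_multi_index: "finite (multi_index m k)"
proof (rule finite_subset)
  show "multi_index m k \<subseteq> {f. \<forall>i. (i \<in> {..<m} \<longrightarrow> f i \<in> {..k}) \<and> (i \<notin> {..<m} \<longrightarrow> f i = 0)}"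
  proof
    fix f assume f: "f \<in> multi_index m k"
    have "f i \<le> k" if "i < m" for i
    proof -
      have "f i \<le> sum f {..<m}" using that by (intro member_le_sum) auto
      then show ?thesis using f by (simp add: multi_index_def)
    qed
    then show "f \<in> {f. \<forall>i. (i \<in> {..<m} \<longrightarrow> f i \<in> {..k}) \<and> (i \<notin> {..<m} \<longrightarrow> f i = 0)}"
      using f by (auto simp: multi_index_def)
  qed
  show "finite {f :: nat \<Rightarrow> nat. \<forall>i. (i \<in> {..<m} \<longrightarrow> f i \<in> {..k}) \<and> (i \<notin> {..<m} \<longrightarrow> f i = 0)}"
    by (rule finite_set_of_finite_funs) auto
qed

lemma reproducing_kernel_exists_aux:
  fixes w :: "'a \<Rightarrow> real" and W :: "('a \<Rightarrow> real) set"
  assumes S: "finite S" and w: "\<And>x. x \<in> S \<Longrightarrow> w x > 0" and T: "T \<subseteq> S"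
    and W0: "(\<lambda>_. 0) \<in> W"
    and Wadd: "\<And>f g. f \<in> W \<Longrightarrow> g \<in> W \<Longrightarrow> (\<lambda>x. f x + g x) \<in> W"
    and Wscale: "\<And>c f. f \<in> W \<Longrightarrow> (\<lambda>x. c * f x) \<in> W"
    and Wsupp: "\<And>f x. f \<in> W \<Longrightarrow> x \<notin> T \<Longrightarrow> f x = 0"
  shows "\<exists>K. (\<forall>x. K x \<in> W) \<and> (\<forall>x y. K x y = K y x) \<and>
             (\<forall>f\<in>W. \<forall>x. (\<Sum>y\<in>S. K x y * f y * w y) = f x)"
proof -
  have "finite T" using S T finite_subset by blast
  then show ?thesis using T W0 Wadd Wscale Wsupp
  proof (induction T arbitrary: W)
    case empty
    then have "f = (\<lambda>_. 0)" if "f \<in> W" for f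
      using empty.prems(5)[OF that] by auto
    then have "f x = 0" if "f \<in> W" for f x using that by metis
    then show ?case using empty.prems(2) by (intro exI[of _ "\<lambda>_ _. 0"]) simp
  next
    case (insert a T)
    define W' where "W' = {f \<in> W. f a = 0}"
    have "\<exists>K. (\<forall>x. K x \<in> W') \<and> (\<forall>x y. K x y = K y x) \<and>
             (\<forall>f\<in>W'. \<forall>x. (\<Sum>y\<in>S. K x y * f y * w y) = f x)"
    proof (rule insert.IH)
      show "f x = 0" if "f \<in> W'" "x \<notin> T" for f x
        using insert.prems(5)[of f x] that by (cases "x = a") (auto simp: W'_def)
    qed (use insert.prems(1-4) in \<open>auto simp: W'_def\<close>)
    then obtain K where K: "\<And>x. K x \<in> W'" and Ks: "\<And>x y. K x y = K y x"
      and Kr: "\<And>f x. f \<in> W' \<Longrightarrow> (\<Sum>y\<in>S. K x y * f y * w y) = f x" by blast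
    show ?case
    proof (cases "W' = W")
      case True
      then show ?thesis using K Ks Kr by blast
    next
      case False
      then obtain g where g: "g \<in> W" "g a \<noteq> 0" unfolding W'_def by blast
      have Wsum: "(\<lambda>x. \<Sum>y\<in>A. h y x) \<in> W" if "\<And>y. h y \<in> W" "finite A"
        for h :: "'a \<Rightarrow> 'a \<Rightarrow> real" and A
        using that(2) by (induction A) (auto intro: insert.prems that)
      define p where "p x = (\<Sum>y\<in>S. (g y * w y) * K y x)" for x
      have pW: "p \<in> W"
      proof -
        have "(\<lambda>x. \<Sum>y\<in>S. (g y * w y) * K y x) \<in> W"
          using K S by (intro Wsum insert.prems(4)) (auto simp: W'_def)
        then show ?thesis unfolding p_def .
      qed
      have Ka: "K x a = 0" for x using K by (simp add: W'_def)
      have pa: "p a = 0" by (simp add: p_def Ka)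
      define e where "e x = g x + (-1) * p x" for x
      have eW: "e \<in> W" unfolding e_def using g pW by (intro insert.prems(3,4))
      have ea: "e a \<noteq> 0" using g pa by (simp add: e_def)
      have orth: "(\<Sum>x\<in>S. e x * f x * w x) = 0" if f: "f \<in> W'" for f
      proof -
        have "(\<Sum>x\<in>S. p x * f x * w x) = (\<Sum>x\<in>S. \<Sum>y\<in>S. (g y * w y) * (K y x * f x * w x))"
          by (simp add: p_def sum_distrib_right sum_distrib_left mult_ac)
        also have "\<dots> = (\<Sum>y\<in>S. (g y * w y) * (\<Sum>x\<in>S. K y x * f x * w x))"
          by (subst sum.swap) (simp add: sum_distrib_left)
        also have "\<dots> = (\<Sum>y\<in>S. g y * f y * w y)"
          by (simp only: Kr[OF f]) (simp add: mult_ac)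
        finally show ?thesis
          by (simp add: e_def algebra_simps sum_subtractf)
      qed
      define E where "E = (\<Sum>x\<in>S. e x * e x * w x)"
      have Epos: "E > 0"
      proof -
        have "a \<in> S" using insert.prems by auto
        moreover have "0 < e a * e a * w a"
          using ea w[OF \<open>a \<in> S\<close>] by (auto simp: zero_less_mult_iff)
        moreover have "0 \<le> e x * e x * w x" if "x \<in> S" for x
          using w[OF that] by simp
        ultimately show ?thesis unfolding E_def using S by (intro sum_pos2[of S a]) auto
      qed
      define K2 where "K2 x y = K x y + (e x / E) * e y" for x y
      have "K2 x \<in> W" for x
        unfolding K2_def using K eW by (intro insert.prems(3,4)) (auto simp: W'_def)
      moreover have "K2 x y = K2 y x" for x y by (simp add: K2_def Ks[of x y])
      moreover have "(\<Sum>y\<in>S. K2 x y * f y * w y) = f x" if f: "f \<in> W" for f x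
      proof -
        define c where "c = f a / e a"
        define h where "h x = f x + (- c) * e x" for x
        have h: "h \<in> W'"
        proof -
          have "h \<in> W" unfolding h_def using f eW by (intro insert.prems(3,4))
          then show ?thesis using ea by (simp add: W'_def h_def c_def)
        qed
        have fh: "f y = h y + c * e y" for y by (simp add: h_def)
        have Ke: "(\<Sum>y\<in>S. K x y * e y * w y) = 0"
          using orth[OF K[of x]] by (simp add: mult_ac)
        have "(\<Sum>y\<in>S. K2 x y * f y * w y) =
            (\<Sum>y\<in>S. K x y * h y * w y) + c * (\<Sum>y\<in>S. K x y * e y * w y)
            + (e x / E) * (\<Sum>y\<in>S. e y * h y * w y) + c * (e x / E) * (\<Sum>y\<in>S. e y * e y * w y)"
          unfolding sum_distrib_left sum.distrib[symmetric]
          by (intro sum.cong refl) (simp add: K2_def fh algebra_simps add_divide_distrib)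
        also have "\<dots> = h x + c * e x"
          using Epos by (simp add: Ke orth[OF h] Kr[OF h] E_def[symmetric])
        finally show ?thesis by (simp add: fh)
      qed
      ultimately show ?thesis by blast
    qed
  qed
qed

lemma krawtchouk_space_cong:
  assumes "f \<in> krawtchouk_space d \<rho> N n"
    and "\<And>x. x \<in> multi_index (Suc d) N \<Longrightarrow> g x = f x"
  shows "g \<in> krawtchouk_space d \<rho> N n"
  using assms by (simp add: krawtchouk_space_def poly_space_def krawtchouk_inner_def)

lemma krawtchouk_space_subspace:
  shows "(\<lambda>_. 0) \<in> krawtchouk_space d \<rho> N n"
    and "\<lbrakk>f \<in> krawtchouk_space d \<rho> N n; g \<in> krawtchouk_space d \<rho> N n\<rbrakk>
          \<Longrightarrow> (\<lambda>x. f x + g x) \<in> krawtchouk_space d \<rho> N n"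
    and "f \<in> krawtchouk_space d \<rho> N n \<Longrightarrow> (\<lambda>x. c * f x) \<in> krawtchouk_space d \<rho> N n"
proof -
  show "(\<lambda>_. 0) \<in> krawtchouk_space d \<rho> N n"
    by (auto simp: krawtchouk_space_def poly_space_def krawtchouk_inner_def intro!: exI[of _ "\<lambda>_. 0"])
next
  assume f: "f \<in> krawtchouk_space d \<rho> N n" and g: "g \<in> krawtchouk_space d \<rho> N n"
  have "(\<lambda>x. f x + g x) \<in> poly_space d N n"
  proof -
    obtain c c' where "\<forall>\<alpha>\<in>multi_index (Suc d) N.
           f \<alpha> = (\<Sum>k\<le>n. \<Sum>\<beta>\<in>multi_index d k. c \<beta> * (\<Prod>i<d. real (\<alpha> i) ^ \<beta> i))"
      "\<forall>\<alpha>\<in>multi_index (Suc d) N.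
           g \<alpha> = (\<Sum>k\<le>n. \<Sum>\<beta>\<in>multi_index d k. c' \<beta> * (\<Prod>i<d. real (\<alpha> i) ^ \<beta> i))"
      using f g unfolding krawtchouk_space_def poly_space_def by blast
    then show ?thesis unfolding poly_space_def
      by (auto simp: sum.distrib distrib_right intro!: exI[of _ "\<lambda>\<beta>. c \<beta> + c' \<beta>"])
  qed
  moreover have "krawtchouk_inner d \<rho> N (\<lambda>x. f x + g x) h
      = krawtchouk_inner d \<rho> N f h + krawtchouk_inner d \<rho> N g h" for h
    by (simp add: krawtchouk_inner_def distrib_left distrib_right sum.distrib add_divide_distrib)
  ultimately show "(\<lambda>x. f x + g x) \<in> krawtchouk_space d \<rho> N n"
    using f g by (auto simp: krawtchouk_space_def)
next
  assume f: "f \<in> krawtchouk_space d \<rho> N n"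
  have "(\<lambda>x. c * f x) \<in> poly_space d N n"
  proof -
    obtain c' where "\<forall>\<alpha>\<in>multi_index (Suc d) N.
           f \<alpha> = (\<Sum>k\<le>n. \<Sum>\<beta>\<in>multi_index d k. c' \<beta> * (\<Prod>i<d. real (\<alpha> i) ^ \<beta> i))"
      using f unfolding krawtchouk_space_def poly_space_def by blast
    then show ?thesis unfolding poly_space_def
      by (auto simp: sum_distrib_left mult.assoc intro!: exI[of _ "\<lambda>\<beta>. c * c' \<beta>"])
  qed
  moreover have "krawtchouk_inner d \<rho> N (\<lambda>x. c * f x) h = c * krawtchouk_inner d \<rho> N f h" for h
    by (simp add: krawtchouk_inner_def sum_distrib_left mult_ac)
  ultimately show "(\<lambda>x. c * f x) \<in> krawtchouk_space d \<rho> N n"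
    using f by (auto simp: krawtchouk_space_def)
qed

lemma krawtchouk_weight_pos:
  assumes "\<forall>i<d. 0 < \<rho> i" and "(\<Sum>i<d. \<rho> i) < 1"
  shows "0 < fact N * (rho_power d \<rho> \<alpha> / multi_fact d \<alpha>)"
  using assms by (auto simp: rho_power_def multi_fact_def full_rho_def
      intro!: mult_pos_pos divide_pos_pos prod_pos)

lemma krawtchouk_kernel_ex1:
  assumes \<rho>: "\<forall>i<d. 0 < \<rho> i" "(\<Sum>i<d. \<rho> i) < 1"
  shows "\<exists>!P. is_reproducing_kernel d \<rho> N n P \<and>
     (\<forall>x y. x \<notin> multi_index (Suc d) N \<or> y \<notin> multi_index (Suc d) N \<longrightarrow> P x y = 0)"
proof -
  let ?S = "multi_index (Suc d) N"
  let ?V = "krawtchouk_space d \<rho> N n"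
  define w where "w \<alpha> = fact N * (rho_power d \<rho> \<alpha> / multi_fact d \<alpha>)" for \<alpha>
  have w: "w \<alpha> > 0" for \<alpha> unfolding w_def by (rule krawtchouk_weight_pos[OF \<rho>])
  have inner: "krawtchouk_inner d \<rho> N f g = (\<Sum>y\<in>?S. f y * g y * w y)" for f g
    by (simp add: krawtchouk_inner_def w_def sum_distrib_left mult_ac)
  define W where "W = {f \<in> ?V. \<forall>x. x \<notin> ?S \<longrightarrow> f x = 0}"
  have "\<exists>K. (\<forall>x. K x \<in> W) \<and> (\<forall>x y. K x y = K y x) \<and>
             (\<forall>f\<in>W. \<forall>x. (\<Sum>y\<in>?S. K x y * f y * w y) = f x)"
    by (rule reproducing_kernel_exists_aux[where T = ?S])
      (auto simp: finite_multi_index w W_def intro: krawtchouk_space_subspace)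
  then obtain K where K: "\<And>x. K x \<in> W" and Ks: "\<And>x y. K x y = K y x"
    and Kr: "\<And>f x. f \<in> W \<Longrightarrow> (\<Sum>y\<in>?S. K x y * f y * w y) = f x" by blast
  have K_rep: "is_reproducing_kernel d \<rho> N n K"
    unfolding is_reproducing_kernel_def
  proof (intro conjI ballI)
    show "(\<lambda>y. K x y) \<in> ?V" for x using K by (simp add: W_def)
    show "(\<lambda>x. K x y) \<in> ?V" for y using K[of y] by (simp add: W_def Ks[of _ y])
  next
    fix x Q assume x: "x \<in> ?S" and Q: "Q \<in> ?V"
    define Q' where "Q' y = (if y \<in> ?S then Q y else 0)" for y
    have "Q' \<in> W" using krawtchouk_space_cong[OF Q, of Q'] by (simp add: W_def Q'_def)
    from Kr[OF this, of x] show "krawtchouk_inner d \<rho> N (K x) Q = Q x"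
      using x by (simp add: inner Q'_def cong: sum.cong)
  qed
  have K0: "K x y = 0" if "x \<notin> ?S \<or> y \<notin> ?S" for x y
    using that K[of x] K[of y] Ks[of x y] by (auto simp: W_def)
  show ?thesis
  proof (rule ex1I[of _ K])
    show "is_reproducing_kernel d \<rho> N n K \<and> (\<forall>x y. x \<notin> ?S \<or> y \<notin> ?S \<longrightarrow> K x y = 0)"
      using K_rep K0 by blast
  next
    fix P assume P: "is_reproducing_kernel d \<rho> N n P \<and> (\<forall>x y. x \<notin> ?S \<or> y \<notin> ?S \<longrightarrow> P x y = 0)"
    have "P x y = K x y" if x: "x \<in> ?S" and y: "y \<in> ?S" for x y
    proof -
      have "P x y = krawtchouk_inner d \<rho> N (K y) (P x)"
        using P K_rep x y by (simp add: is_reproducing_kernel_def)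
      also have "\<dots> = krawtchouk_inner d \<rho> N (P x) (K y)"
        by (simp add: inner mult_ac)
      also have "\<dots> = K y x"
        using P K_rep x y by (simp add: is_reproducing_kernel_def)
      finally show ?thesis by (simp add: Ks)
    qed
    then show "P = K" using P K0 by (intro ext) metis
  qed
qed

end

theory Submission
  imports Defs
begin

text \<open>
  Let \<open>(U f)(z) = \<Sum>\<^sub>j \<rho>\<^sub>j f(z + e\<^sub>j)\<close> map functions on \<open>\<int>\<^sub>N\<close> to functions on
  \<open>\<int>\<^sub>N\<^sub>-\<^sub>1\<close>. The symmetric form \<open>E(f, g) = N \<langle>U f, U g\<rangle>\<close> acts triangularly on products
  of binomial coefficients, so that degree \<open>m\<close> has eigenvalue \<open>N - m\<close>. The coefficient \<open>Q\<^sub>n\<close>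
  of \<open>r\<^sup>n\<close> in the claimed expression has degree at most \<open>n\<close> and satisfies
  \<open>E(Q\<^sub>n, g) = (N - n) \<langle>Q\<^sub>n, g\<rangle>\<close> for all \<open>g\<close>; comparing eigenvalues, it is orthogonal to all
  polynomials of lower degree. At \<open>r = 1\<close> the expression is the reproducing kernel of the space of
  all functions on \<open>\<int>\<^sub>N\<close>, hence each \<open>Q\<^sub>n\<close> is the reproducing kernel of its own degree.
  Each term is nonnegative by inspection.
\<close>

section \<open>Multi-indices and products of binomial coefficients\<close>

text \<open>Up to the factor (-1)^|\<gamma>| \<gamma>!, this is
  \<open>neg_pochhammer d x \<gamma>\<close>. All d + 1 coordinates enter, so on the multi-indices
  of sum N these products form a redundant spanning family of the polynomials.\<close>

definition mbinom :: "nat \<Rightarrow> (nat \<Rightarrow> nat) \<Rightarrow> (nat \<Rightarrow> nat) \<Rightarrow> real" where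
  "mbinom d \<gamma> x = (\<Prod>i\<le>d. real (x i choose \<gamma> i))"

lemma prod_fun_upd:
  assumes "finite A" "j \<in> A"
  shows "(\<Prod>i\<in>A. f i ((z(j := v)) i)) = f j v * (\<Prod>i\<in>A - {j}. f i (z i))"
proof -
  have "(\<Prod>i\<in>A - {j}. f i ((z(j := v)) i)) = (\<Prod>i\<in>A - {j}. f i (z i))"
    by (intro prod.cong) auto
  then show ?thesis using assms by (simp add: prod.remove[of A j])
qed

lemma multi_index_0: "multi_index m 0 = {\<lambda>_. 0}"
proof
  show "multi_index m 0 \<subseteq> {\<lambda>_. 0}"
  proof
    fix \<gamma> assume "\<gamma> \<in> multi_index m 0"
    then have "\<gamma> i = 0" for i by (cases "i < m") (auto simp: multi_index_def)
    then show "\<gamma> \<in> {\<lambda>_. 0}" by auto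
  qed
qed (auto simp: multi_index_def)

lemma multi_index_incr:
  assumes "z \<in> multi_index m k" "i < m"
  shows "z(i := Suc (z i)) \<in> multi_index m (Suc k)"
proof -
  have "(\<Sum>l<m. (z(i := Suc (z i))) l) = Suc (\<Sum>l<m. z l)"
    using assms(2) by (simp add: sum.remove[of "{..<m}" i])
  then show ?thesis using assms by (auto simp: multi_index_def)
qed

lemma multi_index_decr:
  assumes "x \<in> multi_index m (Suc k)" "i < m" "x i > 0"
  shows "x(i := x i - 1) \<in> multi_index m k"
proof -
  have "Suc (\<Sum>l<m. (x(i := x i - 1)) l) = (\<Sum>l<m. x l)"
    using assms(2,3) by (simp add: sum.remove[of "{..<m}" i])
  then show ?thesis using assms by (auto simp: multi_index_def)
qed

lemma multi_index_Suc_obtain: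
  assumes "\<gamma> \<in> multi_index m (Suc k)"
  obtains j where "j < m" "\<gamma> j > 0" "\<gamma>(j := \<gamma> j - 1) \<in> multi_index m k"
proof -
  have "(\<Sum>i<m. \<gamma> i) \<noteq> 0" using assms by (simp add: multi_index_def)
  then obtain j where "j < m" "\<gamma> j > 0" by auto
  then show ?thesis using that multi_index_decr[OF assms] by blast
qed

text \<open>For fixed \<open>i\<close>, subtracting one in coordinate \<open>i\<close> maps the
  multi-indices of sum N + 1 with \<open>x i > 0\<close> bijectively onto those of sum N. This is
  the summation by parts behind the adjoint of \<open>raise\<close> and the lower terms of
  \<open>krawtchouk_F\<close>.\<close>

lemma sum_multi_index_Suc:
  fixes \<phi> :: "(nat \<Rightarrow> nat) \<Rightarrow> nat \<Rightarrow> 'a :: comm_monoid_add"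
  shows "(\<Sum>x\<in>multi_index (Suc d) (Suc N). \<Sum>i\<le>d. if x i > 0 then \<phi> x i else 0)
       = (\<Sum>z\<in>multi_index (Suc d) N. \<Sum>i\<le>d. \<phi> (z(i := Suc (z i))) i)"
proof -
  let ?M = "multi_index (Suc d)"
  have "(\<Sum>x\<in>?M (Suc N). \<Sum>i\<le>d. if x i > 0 then \<phi> x i else 0)
      = (\<Sum>i\<le>d. \<Sum>x\<in>?M (Suc N). if x i > 0 then \<phi> x i else 0)"
    by (rule sum.swap)
  also have "\<dots> = (\<Sum>i\<le>d. \<Sum>z\<in>?M N. \<phi> (z(i := Suc (z i))) i)"
  proof (rule sum.cong[OF refl])
    fix i assume "i \<in> {..d}"
    then have i: "i < Suc d" by simp
    have "(\<Sum>x\<in>?M (Suc N). if x i > 0 then \<phi> x i else 0)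
        = (\<Sum>x\<in>{x \<in> ?M (Suc N). x i > 0}. \<phi> x i)"
      by (simp add: sum.inter_filter finite_multi_index)
    also have "\<dots> = (\<Sum>z\<in>?M N. \<phi> (z(i := Suc (z i))) i)"
      by (rule sum.reindex_bij_witness
          [of _ "\<lambda>z. z(i := Suc (z i))" "\<lambda>x. x(i := x i - 1)"])
        (use multi_index_incr[OF _ i] multi_index_decr[OF _ i] in auto)
    finally show "(\<Sum>x\<in>?M (Suc N). if x i > 0 then \<phi> x i else 0)
        = (\<Sum>z\<in>?M N. \<phi> (z(i := Suc (z i))) i)" .
  qed
  also have "\<dots> = (\<Sum>z\<in>?M N. \<Sum>i\<le>d. \<phi> (z(i := Suc (z i))) i)"
    by (rule sum.swap)
  finally show ?thesis .
qed

lemma sum_full_rho: "(\<Sum>i\<le>d. full_rho d \<rho> i) = 1"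
proof -
  have "(\<Sum>i<d. full_rho d \<rho> i) = (\<Sum>i<d. \<rho> i)" by (simp add: full_rho_def)
  then show ?thesis by (simp add: lessThan_Suc_atMost[symmetric] full_rho_def)
qed

lemma Suc_times_binomial_Suc:
  "real (Suc k) * real (n choose Suc k) = (real n - real k) * real (n choose k)"
proof (cases "k \<le> n")
  case True
  have "Suc k * (n choose Suc k) = (n - k) * (n choose k)"
    using binomial_absorb_comp[of n k] binomial_absorption[of k n] by simp
  then show ?thesis using True by (metis of_nat_diff of_nat_mult)
qed (simp add: binomial_eq_0)

lemma times_binomial_pred:
  "real n * real ((n - 1) choose k) = (real n - real k) * real (n choose k)"
proof (cases "k \<le> n")
  case True
  then show ?thesis using binomial_absorb_comp[of n k] by (metis of_nat_diff of_nat_mult)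
qed (simp add: binomial_eq_0)

text \<open>Solved for \<open>real (x j) * mbinom d \<gamma> x\<close>, this expands multiplication
  by a coordinate. Differences of reals keep it true for \<open>x j < \<gamma> j\<close>, where both
  sides are 0.\<close>

lemma mbinom_incr_index:
  assumes "j \<le> d"
  shows "real (Suc (\<gamma> j)) * mbinom d (\<gamma>(j := Suc (\<gamma> j))) x
       = (real (x j) - real (\<gamma> j)) * mbinom d \<gamma> x"
proof -
  let ?P = "\<Prod>i\<in>{..d} - {j}. real (x i choose \<gamma> i)"
  have "mbinom d (\<gamma>(j := Suc (\<gamma> j))) x = real (x j choose Suc (\<gamma> j)) * ?P"
    unfolding mbinom_def using assms
    by (subst prod_fun_upd[where f = "\<lambda>i v. real (x i choose v)"]) auto
  moreover have "mbinom d \<gamma> x = real (x j choose \<gamma> j) * ?P"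
    unfolding mbinom_def using assms by (intro prod.remove) auto
  ultimately show ?thesis
    by (simp only: mult.assoc[symmetric] Suc_times_binomial_Suc)
qed

text \<open>Absorption in coordinate \<open>j\<close>. At \<open>x j = 0\<close> the truncated
  \<open>x j - 1\<close> is harmless because the factor \<open>real (x j)\<close> vanishes.\<close>

lemma mbinom_decr_arg:
  assumes "j \<le> d"
  shows "real (x j) * mbinom d \<gamma> (x(j := x j - 1)) = (real (x j) - real (\<gamma> j)) * mbinom d \<gamma> x"
proof -
  let ?P = "\<Prod>i\<in>{..d} - {j}. real (x i choose \<gamma> i)"
  have "mbinom d \<gamma> (x(j := x j - 1)) = real ((x j - 1) choose \<gamma> j) * ?P"
    unfolding mbinom_def using assms
    by (subst prod_fun_upd[where f = "\<lambda>i v. real (v choose \<gamma> i)"]) auto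
  moreover have "mbinom d \<gamma> x = real (x j choose \<gamma> j) * ?P"
    unfolding mbinom_def using assms by (intro prod.remove) auto
  ultimately show ?thesis
    by (simp only: mult.assoc[symmetric] times_binomial_pred)
qed

text \<open>Pascal's rule in coordinate \<open>j\<close>. For \<open>\<gamma> j = 0\<close> the
  binomial factor is constantly 1, and the conditional suppresses the spurious term that truncated
  subtraction would add.\<close>

lemma mbinom_incr_arg:
  assumes "j \<le> d"
  shows "mbinom d \<gamma> (z(j := Suc (z j)))
       = mbinom d \<gamma> z + (if \<gamma> j > 0 then mbinom d (\<gamma>(j := \<gamma> j - 1)) z else 0)"
proof -
  let ?P = "\<Prod>i\<in>{..d} - {j}. real (z i choose \<gamma> i)"
  have "mbinom d \<gamma> (z(j := Suc (z j))) = real (Suc (z j) choose \<gamma> j) * ?P"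
    unfolding mbinom_def using assms
    by (subst prod_fun_upd[where f = "\<lambda>i v. real (v choose \<gamma> i)"]) auto
  moreover have "mbinom d \<gamma> z = real (z j choose \<gamma> j) * ?P"
    unfolding mbinom_def using assms by (intro prod.remove) auto
  moreover have "mbinom d (\<gamma>(j := \<gamma> j - 1)) z = real (z j choose (\<gamma> j - 1)) * ?P"
    unfolding mbinom_def using assms
    by (subst prod_fun_upd[where f = "\<lambda>i v. real (z i choose v)"]) auto
  ultimately show ?thesis by (cases "\<gamma> j") (auto simp: distrib_right)
qed

lemma sum_multi_index_diff:
  assumes "x \<in> multi_index (Suc d) N" "\<gamma> \<in> multi_index (Suc d) k"
  shows "(\<Sum>i\<le>d. real (x i) - real (\<gamma> i)) = real N - real k"
proof -
  have "(\<Sum>i\<le>d. x i) = N" "(\<Sum>i\<le>d. \<gamma> i) = k"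
    using assms by (auto simp: multi_index_def lessThan_Suc_atMost)
  then show ?thesis by (simp add: sum_subtractf flip: of_nat_sum)
qed

section \<open>The multinomial weight and bilinearity of the inner product\<close>

text \<open>A further unit in coordinate \<open>j\<close> multiplies the multinomial weight by
  \<rho>_j / (z_j + 1). The factor N! of the inner product is left out here and accounts for the N +
  1 in \<open>raise_adjoint\<close>.\<close>

lemma weight_incr:
  assumes "j \<le> d"
  shows "real (Suc (z j)) * (rho_power d \<rho> (z(j := Suc (z j))) / multi_fact d (z(j := Suc (z j))))
       = full_rho d \<rho> j * (rho_power d \<rho> z / multi_fact d z)"
proof -
  let ?P = "\<Prod>i\<in>{..d} - {j}. full_rho d \<rho> i ^ z i"
  let ?Q = "\<Prod>i\<in>{..d} - {j}. fact (z i) :: real"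
  have "rho_power d \<rho> (z(j := Suc (z j))) = full_rho d \<rho> j ^ Suc (z j) * ?P"
    unfolding rho_power_def using assms
    by (subst prod_fun_upd[where f = "\<lambda>i v. full_rho d \<rho> i ^ v"]) auto
  moreover have "rho_power d \<rho> z = full_rho d \<rho> j ^ z j * ?P"
    unfolding rho_power_def using assms by (intro prod.remove) auto
  moreover have "multi_fact d (z(j := Suc (z j))) = fact (Suc (z j)) * ?Q"
    unfolding multi_fact_def using assms
    by (subst prod_fun_upd[where f = "\<lambda>i v. fact v"]) auto
  moreover have "multi_fact d z = fact (z j) * ?Q"
    unfolding multi_fact_def using assms by (intro prod.remove) auto
  ultimately show ?thesis
    by (simp add: field_simps del: of_nat_Suc)
qed

lemma krawtchouk_inner_commute: "krawtchouk_inner d \<rho> N f g = krawtchouk_inner d \<rho> N g f"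
  by (simp add: krawtchouk_inner_def mult_ac)

lemma krawtchouk_inner_cong:
  assumes "\<And>x. x \<in> multi_index (Suc d) N \<Longrightarrow> f x = f' x"
    and "\<And>x. x \<in> multi_index (Suc d) N \<Longrightarrow> g x = g' x"
  shows "krawtchouk_inner d \<rho> N f g = krawtchouk_inner d \<rho> N f' g'"
  using assms by (simp add: krawtchouk_inner_def)

lemma krawtchouk_inner_add:
  "krawtchouk_inner d \<rho> N (\<lambda>x. f x + g x) h = krawtchouk_inner d \<rho> N f h + krawtchouk_inner d \<rho> N g h"
  by (simp add: krawtchouk_inner_def distrib_left distrib_right sum.distrib add_divide_distrib)

lemma krawtchouk_inner_scale:
  "krawtchouk_inner d \<rho> N (\<lambda>x. c * f x) h = c * krawtchouk_inner d \<rho> N f h"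
  by (simp add: krawtchouk_inner_def sum_distrib_left mult_ac)

lemma krawtchouk_inner_zero: "krawtchouk_inner d \<rho> N (\<lambda>x. 0) h = 0"
  by (simp add: krawtchouk_inner_def)

lemma krawtchouk_inner_sum:
  "krawtchouk_inner d \<rho> N (\<lambda>x. \<Sum>a\<in>A. f a x) h = (\<Sum>a\<in>A. krawtchouk_inner d \<rho> N (f a) h)"
  by (induction A rule: infinite_finite_induct)
    (simp_all add: krawtchouk_inner_zero krawtchouk_inner_add)

section \<open>The averaging operator and its symmetric form\<close>

text \<open>The operator U: the average over one unit added at random with probabilities \<rho>.
  Functions being total, it carries no parameter N; it takes functions on sum N + 1 and is read on
  sum N.\<close>

definition raise :: "nat \<Rightarrow> (nat \<Rightarrow> real) \<Rightarrow> ((nat \<Rightarrow> nat) \<Rightarrow> real) \<Rightarrow> (nat \<Rightarrow> nat) \<Rightarrow> real" where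
  "raise d \<rho> f z = (\<Sum>j\<le>d. full_rho d \<rho> j * f (z(j := Suc (z j))))"

lemma raise_scale: "raise d \<rho> (\<lambda>x. c * f x) = (\<lambda>z. c * raise d \<rho> f z)"
  by (auto simp: raise_def sum_distrib_left mult_ac)

lemma raise_sum: "raise d \<rho> (\<lambda>x. \<Sum>a\<in>A. f a x) = (\<lambda>z. \<Sum>a\<in>A. raise d \<rho> (f a) z)"
  by (rule ext, simp add: raise_def sum_distrib_left, rule sum.swap)

text \<open>Substitute x = z + e_i: \<open>weight_incr\<close> turns the factor x_i into \<rho>_i,
  and the sum over i becomes U. Terms with \<open>x i = 0\<close> vanish by the factor
  \<open>real (x i)\<close>, and (N + 1)! = (N + 1) N! supplies the constant.\<close>

lemma raise_adjoint:
  "real (Suc N) * krawtchouk_inner d \<rho> N h (raise d \<rho> f)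
     = krawtchouk_inner d \<rho> (Suc N) (\<lambda>x. \<Sum>i\<le>d. real (x i) * h (x(i := x i - 1))) f"
proof -
  let ?M = "multi_index (Suc d)"
  let ?w = "\<lambda>\<alpha>. rho_power d \<rho> \<alpha> / multi_fact d \<alpha>"
  have "(\<Sum>x\<in>?M (Suc N). (\<Sum>i\<le>d. real (x i) * h (x(i := x i - 1))) * f x * ?w x)
      = (\<Sum>x\<in>?M (Suc N). \<Sum>i\<le>d. if x i > 0 then real (x i) * h (x(i := x i - 1)) * f x * ?w x else 0)"
    unfolding sum_distrib_right by (intro sum.cong refl) auto
  also have "\<dots> = (\<Sum>z\<in>?M N. \<Sum>i\<le>d. h z * f (z(i := Suc (z i)))
        * (real (Suc (z i)) * ?w (z(i := Suc (z i)))))"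
    by (subst sum_multi_index_Suc) (simp add: mult_ac)
  also have "\<dots> = (\<Sum>z\<in>?M N. \<Sum>i\<le>d. h z * f (z(i := Suc (z i))) * (full_rho d \<rho> i * ?w z))"
    by (intro sum.cong refl) (simp only: weight_incr atMost_iff)
  also have "\<dots> = (\<Sum>z\<in>?M N. h z * raise d \<rho> f z * ?w z)"
    by (simp add: raise_def sum_distrib_left sum_distrib_right sum_divide_distrib mult_ac)
  finally show ?thesis
    by (simp add: krawtchouk_inner_def mult_ac)
qed

text \<open>The adjoint reproduces each \<open>mbinom\<close> up to a factor: by
  \<open>mbinom_decr_arg\<close> the summand for i is multiplied by x_i - \<gamma>_i, and these
  differences add up to N + 1 - k.\<close>

lemma mbinom_raise_adjoint:
  assumes "\<gamma> \<in> multi_index (Suc d) k"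
  shows "real (Suc N) * krawtchouk_inner d \<rho> N (mbinom d \<gamma>) (raise d \<rho> f)
       = (real (Suc N) - real k) * krawtchouk_inner d \<rho> (Suc N) (mbinom d \<gamma>) f"
proof -
  have "(\<Sum>i\<le>d. real (x i) * mbinom d \<gamma> (x(i := x i - 1))) = (real (Suc N) - real k) * mbinom d \<gamma> x"
    if "x \<in> multi_index (Suc d) (Suc N)" for x
    unfolding sum_multi_index_diff[OF that assms, symmetric] sum_distrib_right
    by (intro sum.cong refl) (simp only: mbinom_decr_arg atMost_iff)
  then show ?thesis
    unfolding raise_adjoint unfolding krawtchouk_inner_scale[symmetric]
    by (intro krawtchouk_inner_cong) auto
qed

text \<open>Pascal's rule in each term; the probabilities sum to 1, so the leading term keeps
  coefficient 1.\<close>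

lemma raise_mbinom:
  "raise d \<rho> (mbinom d \<gamma>) = (\<lambda>z. mbinom d \<gamma> z +
     (\<Sum>j\<le>d. (if \<gamma> j > 0 then full_rho d \<rho> j else 0) * mbinom d (\<gamma>(j := \<gamma> j - 1)) z))"
proof
  fix z
  have "raise d \<rho> (mbinom d \<gamma>) z = (\<Sum>j\<le>d. full_rho d \<rho> j * mbinom d \<gamma> z +
     (if \<gamma> j > 0 then full_rho d \<rho> j else 0) * mbinom d (\<gamma>(j := \<gamma> j - 1)) z)"
    unfolding raise_def by (intro sum.cong refl) (auto simp: mbinom_incr_arg distrib_left)
  then show "raise d \<rho> (mbinom d \<gamma>) z = mbinom d \<gamma> z +
     (\<Sum>j\<le>d. (if \<gamma> j > 0 then full_rho d \<rho> j else 0) * mbinom d (\<gamma>(j := \<gamma> j - 1)) z)"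
    by (simp only: sum.distrib sum_distrib_right[symmetric] sum_full_rho mult_1)
qed

lemma raise_form_mbinom_0:
  assumes "\<gamma> \<in> multi_index (Suc d) 0"
  shows "real (Suc N) * krawtchouk_inner d \<rho> N (raise d \<rho> (mbinom d \<gamma>)) (raise d \<rho> g)
       = real (Suc N) * krawtchouk_inner d \<rho> (Suc N) (mbinom d \<gamma>) g"
  using mbinom_raise_adjoint[OF assms] assms by (simp add: multi_index_0 raise_mbinom)

text \<open>Expand the first \<open>raise\<close> by \<open>raise_mbinom\<close> and move the second
  across by \<open>mbinom_raise_adjoint\<close>. The leading factor N - k is (N + 1) - (k + 1), the
  eigenvalue for degree k + 1; the lower terms have degree k and pick up N + 1 - k.\<close>

lemma raise_form_mbinom_Suc:
  assumes "\<gamma> \<in> multi_index (Suc d) (Suc k)"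
  shows "real (Suc N) * krawtchouk_inner d \<rho> N (raise d \<rho> (mbinom d \<gamma>)) (raise d \<rho> g)
       = (real N - real k) * krawtchouk_inner d \<rho> (Suc N) (mbinom d \<gamma>) g
       + (real (Suc N) - real k) * (\<Sum>j\<le>d. if \<gamma> j > 0 then full_rho d \<rho> j *
            krawtchouk_inner d \<rho> (Suc N) (mbinom d (\<gamma>(j := \<gamma> j - 1))) g else 0)"
proof -
  let ?I = "krawtchouk_inner d \<rho>"
  let ?g = "\<lambda>j. \<gamma>(j := \<gamma> j - 1)"
  have "real (Suc N) * ?I N (raise d \<rho> (mbinom d \<gamma>)) (raise d \<rho> g)
      = real (Suc N) * ?I N (mbinom d \<gamma>) (raise d \<rho> g)
      + (\<Sum>j\<le>d. (if \<gamma> j > 0 then full_rho d \<rho> j else 0) *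
           (real (Suc N) * ?I N (mbinom d (?g j)) (raise d \<rho> g)))"
    unfolding raise_mbinom krawtchouk_inner_add krawtchouk_inner_sum krawtchouk_inner_scale
    by (simp add: distrib_left sum_distrib_left mult_ac)
  also have "\<dots> = (real (Suc N) - real (Suc k)) * ?I (Suc N) (mbinom d \<gamma>) g
      + (\<Sum>j\<le>d. (real (Suc N) - real k) * (if \<gamma> j > 0 then full_rho d \<rho> j *
            ?I (Suc N) (mbinom d (?g j)) g else 0))"
  proof (intro arg_cong2[where f = "(+)"] sum.cong refl)
    fix j assume "j \<in> {..d}"
    then have "\<gamma> j > 0 \<Longrightarrow> ?g j \<in> multi_index (Suc d) k"
      using assms by (intro multi_index_decr) auto
    then show "(if \<gamma> j > 0 then full_rho d \<rho> j else 0) *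
           (real (Suc N) * ?I N (mbinom d (?g j)) (raise d \<rho> g))
        = (real (Suc N) - real k) * (if \<gamma> j > 0 then full_rho d \<rho> j *
            ?I (Suc N) (mbinom d (?g j)) g else 0)"
      by (simp add: mbinom_raise_adjoint del: of_nat_Suc)
  qed (rule mbinom_raise_adjoint[OF assms])
  finally show ?thesis by (simp add: sum_distrib_left)
qed

section \<open>The form on the functions \<open>krawtchouk_F\<close>\<close>

lemma krawtchouk_F_commute: "krawtchouk_F d \<rho> k x y = krawtchouk_F d \<rho> k y x"
  by (simp add: krawtchouk_F_def mult.commute)

text \<open>Each Pochhammer symbol is a signed factorial times a binomial coefficient; the signs
  from x and y cancel coordinatewise, and one of the two factors \<gamma>! cancels the
  denominator.\<close>

lemma krawtchouk_F_mbinom: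
  "krawtchouk_F d \<rho> k x y =
     (\<Sum>\<gamma>\<in>multi_index (Suc d) k. multi_fact d \<gamma> / rho_power d \<rho> \<gamma> * mbinom d \<gamma> x * mbinom d \<gamma> y)"
  unfolding krawtchouk_F_def
proof (rule sum.cong[OF refl])
  fix \<gamma>
  have poch: "pochhammer (- real n) k = (- 1) ^ k * fact k * real (n choose k)" for n k
    by (simp add: binomial_gbinomial gbinomial_pochhammer flip: power_mult_distrib mult.assoc)
  have sq: "pochhammer (- real n) k * pochhammer (- real n') k
      = fact k * fact k * (real (n choose k) * real (n' choose k))" for n n' k
  proof -
    have "((- 1) ^ k * a) * ((- 1) ^ k * b) = a * b" for a b :: real
      by (cases "even k") auto
    then show ?thesis unfolding poch mult.assoc by (simp add: mult_ac)
  qed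
  have "neg_pochhammer d x \<gamma> * neg_pochhammer d y \<gamma>
      = multi_fact d \<gamma> * multi_fact d \<gamma> * (mbinom d \<gamma> x * mbinom d \<gamma> y)"
    unfolding neg_pochhammer_def multi_fact_def mbinom_def prod.distrib[symmetric] sq ..
  moreover have "multi_fact d \<gamma> \<noteq> 0" by (simp add: multi_fact_def)
  ultimately show "neg_pochhammer d x \<gamma> * neg_pochhammer d y \<gamma> / (rho_power d \<rho> \<gamma> * multi_fact d \<gamma>)
      = multi_fact d \<gamma> / rho_power d \<rho> \<gamma> * mbinom d \<gamma> x * mbinom d \<gamma> y"
    by simp
qed

lemma raise_form_krawtchouk_F_0:
  "real (Suc N) * krawtchouk_inner d \<rho> N (raise d \<rho> (krawtchouk_F d \<rho> 0 x)) (raise d \<rho> g)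
     = real (Suc N) * krawtchouk_inner d \<rho> (Suc N) (krawtchouk_F d \<rho> 0 x) g"
proof -
  let ?z = "\<lambda>_. 0 :: nat"
  have "krawtchouk_F d \<rho> 0 x = mbinom d ?z"
    by (rule ext) (simp add: krawtchouk_F_mbinom multi_index_0 mbinom_def multi_fact_def rho_power_def)
  then show ?thesis using raise_form_mbinom_0[of ?z d N \<rho> g] by (simp add: multi_index_0)
qed

text \<open>The lower terms reassemble into \<open>krawtchouk_F d \<rho> k x\<close> with the same
  x. One factor N + 1 - k comes from \<open>raise_form_mbinom_Suc\<close>, the other from summing
  x_j - \<delta>_j over j.\<close>

lemma raise_form_krawtchouk_F_Suc:
  assumes \<rho>: "\<And>j. j \<le> d \<Longrightarrow> full_rho d \<rho> j \<noteq> 0" and x: "x \<in> multi_index (Suc d) (Suc N)"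
  shows "real (Suc N) * krawtchouk_inner d \<rho> N (raise d \<rho> (krawtchouk_F d \<rho> (Suc k) x)) (raise d \<rho> g)
       = (real N - real k) * krawtchouk_inner d \<rho> (Suc N) (krawtchouk_F d \<rho> (Suc k) x) g
       + (real (Suc N) - real k)\<^sup>2 * krawtchouk_inner d \<rho> (Suc N) (krawtchouk_F d \<rho> k x) g"
proof -
  let ?M = "multi_index (Suc d)"
  define c where "c \<gamma> = multi_fact d \<gamma> / rho_power d \<rho> \<gamma> * mbinom d \<gamma> x" for \<gamma>
  define I where "I \<gamma> = krawtchouk_inner d \<rho> (Suc N) (mbinom d \<gamma>) g" for \<gamma>
  have F: "krawtchouk_F d \<rho> k x = (\<lambda>y. \<Sum>\<gamma>\<in>?M k. c \<gamma> * mbinom d \<gamma> y)" for k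
    by (rule ext) (simp add: krawtchouk_F_mbinom c_def)
  have IF: "krawtchouk_inner d \<rho> (Suc N) (krawtchouk_F d \<rho> k x) g = (\<Sum>\<gamma>\<in>?M k. c \<gamma> * I \<gamma>)" for k
    unfolding F krawtchouk_inner_sum krawtchouk_inner_scale I_def ..
  have rp: "rho_power d \<rho> \<gamma> \<noteq> 0" for \<gamma> using \<rho> by (simp add: rho_power_def)
  have mf: "multi_fact d \<gamma> \<noteq> 0" for \<gamma> by (simp add: multi_fact_def)
  \<comment> \<open>From \<delta> to \<delta> + e_j the inverse weight gains (\<delta>_j + 1) /
    \<rho>_j. The given \<rho>_j cancels, and \<delta>_j + 1 is absorbed by the binomial coefficient
    at x.\<close>
  have c_incr: "c (\<delta>(j := Suc (\<delta> j))) * full_rho d \<rho> j = (real (x j) - real (\<delta> j)) * c \<delta>"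
    if j: "j \<le> d" for \<delta> j
  proof -
    let ?\<delta> = "\<delta>(j := Suc (\<delta> j))"
    have "multi_fact d ?\<delta> / rho_power d \<rho> ?\<delta> * full_rho d \<rho> j
        = real (Suc (\<delta> j)) * (multi_fact d \<delta> / rho_power d \<rho> \<delta>)"
      using weight_incr[OF j, of \<delta> \<rho>] rp[of \<delta>] rp[of ?\<delta>] mf[of \<delta>] mf[of ?\<delta>]
      by (simp add: divide_simps del: of_nat_Suc) (simp add: mult_ac del: of_nat_Suc)
    then have "c ?\<delta> * full_rho d \<rho> j
        = multi_fact d \<delta> / rho_power d \<rho> \<delta> * (real (Suc (\<delta> j)) * mbinom d ?\<delta> x)"
      by (simp add: c_def mult_ac del: of_nat_Suc times_divide_eq_left times_divide_eq_right)
    then show ?thesis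
      unfolding mbinom_incr_index[OF j] c_def by (simp add: mult_ac)
  qed
  \<comment> \<open>Reindex by \<delta> = \<gamma> - e_j: every \<delta> of sum k collects one
    contribution from each coordinate j.\<close>
  have "(\<Sum>\<gamma>\<in>?M (Suc k). c \<gamma> * (\<Sum>j\<le>d. if \<gamma> j > 0 then full_rho d \<rho> j * I (\<gamma>(j := \<gamma> j - 1)) else 0))
      = (\<Sum>\<gamma>\<in>?M (Suc k). \<Sum>j\<le>d. if \<gamma> j > 0 then c \<gamma> * full_rho d \<rho> j * I (\<gamma>(j := \<gamma> j - 1)) else 0)"
    unfolding sum_distrib_left by (intro sum.cong refl) simp
  also have "\<dots> = (\<Sum>\<delta>\<in>?M k. \<Sum>j\<le>d. c (\<delta>(j := Suc (\<delta> j))) * full_rho d \<rho> j * I \<delta>)"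
    by (subst sum_multi_index_Suc) simp
  also have "\<dots> = (\<Sum>\<delta>\<in>?M k. \<Sum>j\<le>d. (real (x j) - real (\<delta> j)) * c \<delta> * I \<delta>)"
    by (intro sum.cong refl) (simp only: c_incr atMost_iff)
  also have "\<dots> = (real (Suc N) - real k) * (\<Sum>\<delta>\<in>?M k. c \<delta> * I \<delta>)"
    unfolding sum_distrib_right[symmetric] sum_distrib_left
    by (intro sum.cong refl) (simp only: sum_multi_index_diff[OF x] mult.assoc)
  finally have lower: "(\<Sum>\<gamma>\<in>?M (Suc k). c \<gamma> * (\<Sum>j\<le>d. if \<gamma> j > 0 then
        full_rho d \<rho> j * I (\<gamma>(j := \<gamma> j - 1)) else 0))
      = (real (Suc N) - real k) * (\<Sum>\<delta>\<in>?M k. c \<delta> * I \<delta>)" .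
  have "real (Suc N) * krawtchouk_inner d \<rho> N (raise d \<rho> (krawtchouk_F d \<rho> (Suc k) x)) (raise d \<rho> g)
      = (\<Sum>\<gamma>\<in>?M (Suc k). c \<gamma> *
          (real (Suc N) * krawtchouk_inner d \<rho> N (raise d \<rho> (mbinom d \<gamma>)) (raise d \<rho> g)))"
    unfolding F raise_sum raise_scale krawtchouk_inner_sum krawtchouk_inner_scale
    by (simp add: sum_distrib_left mult_ac)
  also have "\<dots> = (\<Sum>\<gamma>\<in>?M (Suc k). (real N - real k) * (c \<gamma> * I \<gamma>) + (real (Suc N) - real k) *
        (c \<gamma> * (\<Sum>j\<le>d. if \<gamma> j > 0 then full_rho d \<rho> j * I (\<gamma>(j := \<gamma> j - 1)) else 0)))"
    by (intro sum.cong refl) (simp only: raise_form_mbinom_Suc I_def distrib_left mult.left_commute)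
  also have "\<dots> = (real N - real k) * (\<Sum>\<gamma>\<in>?M (Suc k). c \<gamma> * I \<gamma>)
      + (real (Suc N) - real k) * ((real (Suc N) - real k) * (\<Sum>\<delta>\<in>?M k. c \<delta> * I \<delta>))"
    unfolding sum.distrib sum_distrib_left[symmetric] lower ..
  finally show ?thesis unfolding IF by (simp add: power2_eq_square mult.assoc)
qed

section \<open>Coefficients in powers of r and the eigenvalue equation\<close>

text \<open>For k \<le> n \<le> N, the coefficient of r^n in (N - k)!/N! r^k (1 - r)^(N - k), where
  (N - k)!/N! equals (-1)^k / (-N)_k.\<close>

definition kernel_coeff :: "nat \<Rightarrow> nat \<Rightarrow> nat \<Rightarrow> real" where
  "kernel_coeff N n k = (- 1) ^ (n - k) * real ((N - k) choose (n - k)) * (fact (N - k) / fact N)"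

text \<open>The coefficient of \<open>r\<^sup>n\<close> in the claimed expression for the Poisson kernel.\<close>

definition explicit_kernel ::
    "nat \<Rightarrow> (nat \<Rightarrow> real) \<Rightarrow> nat \<Rightarrow> nat \<Rightarrow> (nat \<Rightarrow> nat) \<Rightarrow> (nat \<Rightarrow> nat) \<Rightarrow> real" where
  "explicit_kernel d \<rho> N n x y = (\<Sum>k\<le>n. kernel_coeff N n k * krawtchouk_F d \<rho> k x y)"

lemma explicit_kernel_commute: "explicit_kernel d \<rho> N n x y = explicit_kernel d \<rho> N n y x"
  unfolding explicit_kernel_def by (subst krawtchouk_F_commute) (rule refl)

text \<open>With b_k for \<open>kernel_coeff N n k\<close>, this says b_(k+1) (N - k)^2 = -(n - k)
  b_k. It compares the coefficients of \<open>krawtchouk_F\<close> at index k in the equation with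
  eigenvalue N - n.\<close>

lemma kernel_coeff_Suc:
  assumes "k < n" "n \<le> N"
  shows "kernel_coeff N n k * (real N - real k) + kernel_coeff N n (Suc k) * (real N - real k)\<^sup>2
       = (real N - real n) * kernel_coeff N n k"
proof -
  \<comment> \<open>With N - k = m + 1 and n - k = l + 1 the truncated subtractions disappear, and
    the claim reduces to the absorption identity \<open>b\<close>.\<close>
  obtain l where n: "n = Suc (k + l)" using assms(1) less_imp_Suc_add by blast
  obtain p where N: "N = n + p" using assms(2) le_Suc_ex by blast
  define m where "m = l + p"
  have Nk: "N - k = Suc m" "n - k = Suc l" "N - Suc k = m" "n - Suc k = l"
    by (simp_all add: n N m_def)
  have r: "real N - real k = real (Suc m)" "real N - real n = real (Suc m) - real (Suc l)"
    by (simp_all add: n N m_def)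
  have b: "real (Suc m) * real (m choose l) = real (Suc m choose Suc l) * real (Suc l)"
    using Suc_times_binomial_eq[of m l] by (metis of_nat_mult)
  have "kernel_coeff N n (Suc k) * (real N - real k)\<^sup>2
      = (- 1) ^ l * (real (Suc m) * real (m choose l)) * (real (Suc m) * fact m / fact N)"
    by (simp add: kernel_coeff_def Nk r power2_eq_square del: of_nat_Suc)
  also have "\<dots> = - real (Suc l) * kernel_coeff N n k"
    unfolding b by (simp add: kernel_coeff_def Nk del: of_nat_Suc binomial_Suc_Suc)
  finally show ?thesis by (simp add: r algebra_simps del: of_nat_Suc)
qed

text \<open>Index k < n is fed by its own diagonal term and by the lower term of index k + 1;
  \<open>kernel_coeff_Suc\<close> makes both add up to the eigenvalue N + 1 - n.\<close>

lemma raise_form_explicit_kernel: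
  assumes \<rho>: "\<And>j. j \<le> d \<Longrightarrow> full_rho d \<rho> j \<noteq> 0" and x: "x \<in> multi_index (Suc d) (Suc N)"
    and n: "n \<le> Suc N"
  shows "real (Suc N) * krawtchouk_inner d \<rho> N (raise d \<rho> (explicit_kernel d \<rho> (Suc N) n x)) (raise d \<rho> g)
       = (real (Suc N) - real n) * krawtchouk_inner d \<rho> (Suc N) (explicit_kernel d \<rho> (Suc N) n x) g"
proof -
  define b where "b = kernel_coeff (Suc N) n"
  define I where "I k = krawtchouk_inner d \<rho> (Suc N) (krawtchouk_F d \<rho> k x) g" for k
  define E where "E k = real (Suc N) *
      krawtchouk_inner d \<rho> N (raise d \<rho> (krawtchouk_F d \<rho> k x)) (raise d \<rho> g)" for k
  have Q: "explicit_kernel d \<rho> (Suc N) n x = (\<lambda>y. \<Sum>k\<le>n. b k * krawtchouk_F d \<rho> k x y)"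
    by (rule ext) (simp add: explicit_kernel_def b_def)
  have E0: "E 0 = real (Suc N) * I 0"
    unfolding E_def I_def by (rule raise_form_krawtchouk_F_0)
  have ES: "E (Suc k) = (real (Suc N) - real (Suc k)) * I (Suc k) + (real (Suc N) - real k)\<^sup>2 * I k" for k
    using raise_form_krawtchouk_F_Suc[OF \<rho> x, of k g] unfolding E_def I_def by simp
  have bS: "b k * (real (Suc N) - real k) + b (Suc k) * (real (Suc N) - real k)\<^sup>2
      = (real (Suc N) - real n) * b k" if "k < n" for k
    unfolding b_def by (rule kernel_coeff_Suc[OF that n])
  have "real (Suc N) * krawtchouk_inner d \<rho> N (raise d \<rho> (explicit_kernel d \<rho> (Suc N) n x)) (raise d \<rho> g)
      = (\<Sum>k\<le>n. b k * E k)"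
    unfolding Q raise_sum raise_scale krawtchouk_inner_sum krawtchouk_inner_scale E_def
    by (simp add: sum_distrib_left mult_ac)
  also have "\<dots> = b 0 * E 0 + (\<Sum>k<n. b (Suc k) * E (Suc k))"
    by (rule sum.atMost_shift)
  also have "\<dots> = (b 0 * ((real (Suc N) - real 0) * I 0)
        + (\<Sum>k<n. b (Suc k) * ((real (Suc N) - real (Suc k)) * I (Suc k))))
      + (\<Sum>k<n. b (Suc k) * ((real (Suc N) - real k)\<^sup>2 * I k))"
    unfolding E0 ES distrib_left sum.distrib by simp
  also have "\<dots> = (\<Sum>k\<le>n. b k * ((real (Suc N) - real k) * I k))
      + (\<Sum>k<n. b (Suc k) * ((real (Suc N) - real k)\<^sup>2 * I k))"
    by (subst sum.atMost_shift) (rule refl)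
  \<comment> \<open>Regroup by \<open>I k\<close>. The top index n receives nothing from above and
    already carries the factor N + 1 - n.\<close>
  also have "\<dots> = b n * ((real (Suc N) - real n) * I n) + (\<Sum>k<n. b k * ((real (Suc N) - real k) * I k)
      + b (Suc k) * ((real (Suc N) - real k)\<^sup>2 * I k))"
    by (simp only: lessThan_Suc_atMost[symmetric] sum.lessThan_Suc sum.distrib add_ac)
  also have "\<dots> = b n * ((real (Suc N) - real n) * I n) + (\<Sum>k<n. (real (Suc N) - real n) * (b k * I k))"
    by (intro arg_cong2[where f = "(+)"] sum.cong refl)
      (simp only: mult.assoc[symmetric] distrib_right[symmetric] bS lessThan_iff)
  also have "\<dots> = (real (Suc N) - real n) * (\<Sum>k\<le>n. b k * I k)"
    by (simp only: lessThan_Suc_atMost[symmetric] sum.lessThan_Suc sum_distrib_left distrib_left)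
      (simp only: add_ac mult_ac)
  finally show ?thesis
    unfolding Q krawtchouk_inner_sum krawtchouk_inner_scale I_def .
qed

section \<open>Orthogonality to polynomials of lower degree\<close>

text \<open>Evaluate the form on \<open>mbinom d \<beta>\<close> and the kernel twice: the
  eigenvalue equation gives the factor N - n, triangularity and induction on m give N - m. Since m <
  n, the inner product vanishes.\<close>

lemma explicit_kernel_orthogonal_mbinom:
  assumes \<rho>: "\<And>j. j \<le> d \<Longrightarrow> full_rho d \<rho> j \<noteq> 0" and x: "x \<in> multi_index (Suc d) N"
    and n: "n \<le> N" and \<beta>: "\<beta> \<in> multi_index (Suc d) m" and m: "m < n"
  shows "krawtchouk_inner d \<rho> N (mbinom d \<beta>) (explicit_kernel d \<rho> N n x) = 0"
proof -
  obtain N' where N: "N = Suc N'" using n m by (cases N) auto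
  let ?Q = "explicit_kernel d \<rho> N n x"
  let ?I = "\<lambda>\<beta>. krawtchouk_inner d \<rho> N (mbinom d \<beta>) ?Q"
  have E: "real N * krawtchouk_inner d \<rho> N' (raise d \<rho> (mbinom d \<beta>)) (raise d \<rho> ?Q)
      = (real N - real n) * ?I \<beta>" for \<beta>
    using raise_form_explicit_kernel[OF \<rho>, of x N' n "mbinom d \<beta>"] x n
    by (simp add: N krawtchouk_inner_commute)
  show ?thesis using \<beta> m
  proof (induction m arbitrary: \<beta>)
    case 0
    have "real N * ?I \<beta> = (real N - real n) * ?I \<beta>"
      using E[of \<beta>] raise_form_mbinom_0[OF 0(1), of N' \<rho> ?Q] by (simp add: N)
    then show ?case using 0(2) by (simp add: algebra_simps)
  next
    case (Suc m)
    have lower: "(if \<beta> j > 0 then full_rho d \<rho> j * ?I (\<beta>(j := \<beta> j - 1)) else 0) = 0"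
      if "j \<in> {..d}" for j
    proof (cases "\<beta> j > 0")
      case True
      then have "\<beta>(j := \<beta> j - 1) \<in> multi_index (Suc d) m"
        using that by (intro multi_index_decr[OF Suc.prems(1)]) auto
      then have "?I (\<beta>(j := \<beta> j - 1)) = 0" using Suc.IH Suc.prems(2) by (metis Suc_lessD)
      then show ?thesis by simp
    qed simp
    have "(real N - real n) * ?I \<beta> = (real N' - real m) * ?I \<beta>"
      using E[of \<beta>] raise_form_mbinom_Suc[OF Suc.prems(1), of N' \<rho> ?Q] sum.neutral[OF ballI, OF lower, of "{..d}" "\<lambda>j. j"]
      unfolding N by simp
    then have "(real n - real (Suc m)) * ?I \<beta> = 0" by (simp add: N algebra_simps)
    then show ?case using Suc.prems(2) by simp
  qed
qed

text \<open>The mixed products interpolate between monomials (\<gamma> = 0) and binomial products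
  (\<beta> = 0). Expanding a factor y_j by \<open>mbinom_incr_index\<close> trades one monomial
  degree for at most one unit of \<gamma>, so a + m never grows and induction on a ends at
  \<open>orth\<close>.\<close>

lemma orthogonal_monomial_mbinom:
  assumes orth: "\<And>\<gamma> m. \<gamma> \<in> multi_index (Suc d) m \<Longrightarrow> m < n \<Longrightarrow> krawtchouk_inner d \<rho> N (mbinom d \<gamma>) f = 0"
    and "\<beta> \<in> multi_index d a" and "\<gamma> \<in> multi_index (Suc d) m" and "a + m < n"
  shows "krawtchouk_inner d \<rho> N (\<lambda>y. (\<Prod>i<d. real (y i) ^ \<beta> i) * mbinom d \<gamma> y) f = 0"
  using assms(2-)
proof (induction a arbitrary: \<beta> \<gamma> m)
  case 0
  then show ?case using orth[of \<gamma> m] by (simp add: multi_index_0)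
next
  case (Suc a)
  obtain j where j: "j < d" "\<beta> j > 0" and \<beta>': "\<beta>(j := \<beta> j - 1) \<in> multi_index d a"
    using Suc.prems(1) by (rule multi_index_Suc_obtain)
  let ?\<beta> = "\<beta>(j := \<beta> j - 1)" and ?\<gamma> = "\<gamma>(j := Suc (\<gamma> j))"
  let ?p = "\<lambda>\<beta> y. \<Prod>i<d. real (y i) ^ \<beta> i"
  have p: "?p \<beta> y = real (y j) * ?p ?\<beta> y" for y
  proof -
    have "?p ?\<beta> y = real (y j) ^ (\<beta> j - 1) * (\<Prod>i\<in>{..<d} - {j}. real (y i) ^ \<beta> i)"
      using j by (subst prod_fun_upd[where f = "\<lambda>i v. real (y i) ^ v"]) auto
    moreover have "?p \<beta> y = real (y j) ^ \<beta> j * (\<Prod>i\<in>{..<d} - {j}. real (y i) ^ \<beta> i)"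
      using j by (intro prod.remove) auto
    moreover have "real (y j) ^ \<beta> j = real (y j) * real (y j) ^ (\<beta> j - 1)"
      using j(2) by (simp add: power_eq_if)
    ultimately show ?thesis by (simp only: mult.assoc)
  qed
  have "?p \<beta> y * mbinom d \<gamma> y = real (Suc (\<gamma> j)) * (?p ?\<beta> y * mbinom d ?\<gamma> y)
      + real (\<gamma> j) * (?p ?\<beta> y * mbinom d \<gamma> y)" for y
  proof -
    have "real (y j) * mbinom d \<gamma> y = real (Suc (\<gamma> j)) * mbinom d ?\<gamma> y + real (\<gamma> j) * mbinom d \<gamma> y"
      using mbinom_incr_index[of j d \<gamma> y] j(1) by (simp add: left_diff_distrib)
    then have "?p ?\<beta> y * (real (y j) * mbinom d \<gamma> y)
        = ?p ?\<beta> y * (real (Suc (\<gamma> j)) * mbinom d ?\<gamma> y + real (\<gamma> j) * mbinom d \<gamma> y)"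
      by (rule arg_cong)
    then show ?thesis unfolding p by (simp only: distrib_left mult_ac)
  qed
  then have "krawtchouk_inner d \<rho> N (\<lambda>y. ?p \<beta> y * mbinom d \<gamma> y) f
      = real (Suc (\<gamma> j)) * krawtchouk_inner d \<rho> N (\<lambda>y. ?p ?\<beta> y * mbinom d ?\<gamma> y) f
      + real (\<gamma> j) * krawtchouk_inner d \<rho> N (\<lambda>y. ?p ?\<beta> y * mbinom d \<gamma> y) f"
    by (simp only: krawtchouk_inner_add krawtchouk_inner_scale)
  moreover have "?\<gamma> \<in> multi_index (Suc d) (Suc m)"
    using multi_index_incr[OF Suc.prems(2)] j(1) by simp
  then have "krawtchouk_inner d \<rho> N (\<lambda>y. ?p ?\<beta> y * mbinom d ?\<gamma> y) f = 0"
    by (rule Suc.IH[OF \<beta>']) (use Suc.prems in simp)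
  moreover have "krawtchouk_inner d \<rho> N (\<lambda>y. ?p ?\<beta> y * mbinom d \<gamma> y) f = 0"
    by (rule Suc.IH[OF \<beta>']) (use Suc.prems in auto)
  ultimately show ?case by (simp only: mult_zero_right add_0)
qed

lemma orthogonal_poly_space:
  assumes orth: "\<And>\<gamma> m. \<gamma> \<in> multi_index (Suc d) m \<Longrightarrow> m < n \<Longrightarrow> krawtchouk_inner d \<rho> N (mbinom d \<gamma>) f = 0"
    and g: "g \<in> poly_space d N m" and m: "m < n"
  shows "krawtchouk_inner d \<rho> N g f = 0"
proof -
  let ?p = "\<lambda>\<beta> y. \<Prod>i<d. real (y i) ^ \<beta> i"
  obtain c where c: "\<And>y. y \<in> multi_index (Suc d) N \<Longrightarrow>
      g y = (\<Sum>k\<le>m. \<Sum>\<beta>\<in>multi_index d k. c \<beta> * ?p \<beta> y)"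
    using g unfolding poly_space_def by blast
  have "krawtchouk_inner d \<rho> N g f
      = krawtchouk_inner d \<rho> N (\<lambda>y. \<Sum>k\<le>m. \<Sum>\<beta>\<in>multi_index d k. c \<beta> * ?p \<beta> y) f"
    using c by (rule krawtchouk_inner_cong) auto
  also have "\<dots> = (\<Sum>k\<le>m. \<Sum>\<beta>\<in>multi_index d k. c \<beta> * krawtchouk_inner d \<rho> N (?p \<beta>) f)"
    by (simp only: krawtchouk_inner_sum krawtchouk_inner_scale)
  also have "\<dots> = 0"
  proof (intro sum.neutral ballI)
    fix k \<beta> assume "k \<in> {..m}" "\<beta> \<in> multi_index d k"
    \<comment> \<open>The factor with index 0 is 1; inserting it gives the monomial the form treated
      in \<open>orthogonal_monomial_mbinom\<close>.\<close>
    then have "krawtchouk_inner d \<rho> N (\<lambda>y. ?p \<beta> y * mbinom d (\<lambda>_. 0) y) f = 0"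
      using m by (intro orthogonal_monomial_mbinom[where n = n and a = k and m = 0])
        (auto simp: multi_index_0 intro: orth)
    then show "c \<beta> * krawtchouk_inner d \<rho> N (?p \<beta>) f = 0"
      by (simp add: mbinom_def)
  qed
  finally show ?thesis .
qed

section \<open>Closure properties of the polynomial spaces and the degree of the kernel\<close>

lemma poly_space_cong:
  assumes "f \<in> poly_space d N n" "\<And>x. x \<in> multi_index (Suc d) N \<Longrightarrow> g x = f x"
  shows "g \<in> poly_space d N n"
  using assms by (simp add: poly_space_def)

lemma poly_space_zero: "(\<lambda>_. 0) \<in> poly_space d N n"
  by (auto simp: poly_space_def intro!: exI[of _ "\<lambda>_. 0"])

lemma poly_space_add:
  assumes "f \<in> poly_space d N n" "g \<in> poly_space d N n"
  shows "(\<lambda>x. f x + g x) \<in> poly_space d N n"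
proof -
  obtain c c' where "\<forall>\<alpha>\<in>multi_index (Suc d) N.
         f \<alpha> = (\<Sum>k\<le>n. \<Sum>\<beta>\<in>multi_index d k. c \<beta> * (\<Prod>i<d. real (\<alpha> i) ^ \<beta> i))"
    "\<forall>\<alpha>\<in>multi_index (Suc d) N.
         g \<alpha> = (\<Sum>k\<le>n. \<Sum>\<beta>\<in>multi_index d k. c' \<beta> * (\<Prod>i<d. real (\<alpha> i) ^ \<beta> i))"
    using assms unfolding poly_space_def by blast
  then show ?thesis unfolding poly_space_def
    by (auto simp: sum.distrib distrib_right intro!: exI[of _ "\<lambda>\<beta>. c \<beta> + c' \<beta>"])
qed

lemma poly_space_scale:
  assumes "f \<in> poly_space d N n"
  shows "(\<lambda>x. a * f x) \<in> poly_space d N n"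
proof -
  obtain c where "\<forall>\<alpha>\<in>multi_index (Suc d) N.
         f \<alpha> = (\<Sum>k\<le>n. \<Sum>\<beta>\<in>multi_index d k. c \<beta> * (\<Prod>i<d. real (\<alpha> i) ^ \<beta> i))"
    using assms unfolding poly_space_def by blast
  then show ?thesis unfolding poly_space_def
    by (auto simp: sum_distrib_left mult.assoc intro!: exI[of _ "\<lambda>\<beta>. a * c \<beta>"])
qed

lemma poly_space_sum:
  assumes "\<And>a. a \<in> A \<Longrightarrow> f a \<in> poly_space d N n"
  shows "(\<lambda>x. \<Sum>a\<in>A. f a x) \<in> poly_space d N n"
  using assms
  by (induction A rule: infinite_finite_induct) (auto intro: poly_space_zero poly_space_add)

lemma poly_space_monomial:
  assumes "\<beta> \<in> multi_index d k" "k \<le> n"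
  shows "(\<lambda>x. \<Prod>i<d. real (x i) ^ \<beta> i) \<in> poly_space d N n"
proof -
  have "(\<Sum>l\<le>n. \<Sum>\<beta>'\<in>multi_index d l. (if \<beta>' = \<beta> then 1 else 0) * (\<Prod>i<d. real (x i) ^ \<beta>' i))
      = (\<Prod>i<d. real (x i) ^ \<beta> i)" for x :: "nat \<Rightarrow> nat"
  proof -
    have "(\<Sum>\<beta>'\<in>multi_index d l. (if \<beta>' = \<beta> then 1 else 0) * (\<Prod>i<d. real (x i) ^ \<beta>' i))
        = (if l = k then \<Prod>i<d. real (x i) ^ \<beta> i else 0)" for l
    proof -
      have "(\<Sum>\<beta>'\<in>multi_index d l. (if \<beta>' = \<beta> then 1 else 0) * (\<Prod>i<d. real (x i) ^ \<beta>' i))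
          = (\<Sum>\<beta>'\<in>multi_index d l. if \<beta>' = \<beta> then \<Prod>i<d. real (x i) ^ \<beta> i else 0)"
        by (intro sum.cong) auto
      moreover have "\<beta> \<in> multi_index d l \<longleftrightarrow> l = k"
        using assms(1) by (auto simp: multi_index_def)
      ultimately show ?thesis by (simp add: finite_multi_index)
    qed
    then show ?thesis using assms(2) by simp
  qed
  then show ?thesis unfolding poly_space_def by (auto intro!: exI[of _ "\<lambda>\<beta>'. if \<beta>' = \<beta> then 1 else 0"])
qed

text \<open>The coefficients \<open>c\<close> cannot be reused as they stand, being unconstrained on
  degrees n + 1 to m; the polynomial is rebuilt from its monomials.\<close>

lemma poly_space_mono:
  assumes "f \<in> poly_space d N n" "n \<le> m"
  shows "f \<in> poly_space d N m"
proof -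
  obtain c where "\<And>\<alpha>. \<alpha> \<in> multi_index (Suc d) N \<Longrightarrow>
         f \<alpha> = (\<Sum>k\<le>n. \<Sum>\<beta>\<in>multi_index d k. c \<beta> * (\<Prod>i<d. real (\<alpha> i) ^ \<beta> i))"
    using assms(1) unfolding poly_space_def by blast
  moreover have "(\<lambda>\<alpha>. \<Sum>k\<le>n. \<Sum>\<beta>\<in>multi_index d k. c \<beta> * (\<Prod>i<d. real (\<alpha> i) ^ \<beta> i)) \<in> poly_space d N m"
    using assms(2) by (intro poly_space_sum poly_space_scale) (auto intro: poly_space_monomial)
  ultimately show ?thesis by (rule poly_space_cong[rotated])
qed

lemma poly_space_times_coord:
  assumes f: "f \<in> poly_space d N n" and j: "j \<le> d"
  shows "(\<lambda>x. real (x j) * f x) \<in> poly_space d N (Suc n)"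
proof -
  have coord: "(\<lambda>x. real (x j) * f x) \<in> poly_space d N (Suc n)" if j: "j < d" for j
  proof -
    let ?p = "\<lambda>\<beta> y. \<Prod>i<d. real (y i) ^ \<beta> i"
    obtain c where c: "\<And>\<alpha>. \<alpha> \<in> multi_index (Suc d) N \<Longrightarrow>
           f \<alpha> = (\<Sum>k\<le>n. \<Sum>\<beta>\<in>multi_index d k. c \<beta> * ?p \<beta> \<alpha>)"
      using f unfolding poly_space_def by blast
    have p: "real (y j) * ?p \<beta> y = ?p (\<beta>(j := Suc (\<beta> j))) y" for \<beta> and y :: "nat \<Rightarrow> nat"
    proof -
      have "?p (\<beta>(j := Suc (\<beta> j))) y = real (y j) ^ Suc (\<beta> j) * (\<Prod>i\<in>{..<d} - {j}. real (y i) ^ \<beta> i)"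
        using j by (subst prod_fun_upd[where f = "\<lambda>i v. real (y i) ^ v"]) auto
      moreover have "?p \<beta> y = real (y j) ^ \<beta> j * (\<Prod>i\<in>{..<d} - {j}. real (y i) ^ \<beta> i)"
        using j by (intro prod.remove) auto
      ultimately show ?thesis by simp
    qed
    have "(\<lambda>\<alpha>. \<Sum>k\<le>n. \<Sum>\<beta>\<in>multi_index d k. c \<beta> * ?p (\<beta>(j := Suc (\<beta> j))) \<alpha>) \<in> poly_space d N (Suc n)"
      using j by (intro poly_space_sum poly_space_scale poly_space_monomial[OF multi_index_incr]) auto
    moreover have "real (\<alpha> j) * f \<alpha> = (\<Sum>k\<le>n. \<Sum>\<beta>\<in>multi_index d k. c \<beta> * ?p (\<beta>(j := Suc (\<beta> j))) \<alpha>)"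
      if "\<alpha> \<in> multi_index (Suc d) N" for \<alpha>
      unfolding p[symmetric] c[OF that] by (simp add: sum_distrib_left mult.left_commute)
    ultimately show ?thesis by (rule poly_space_cong)
  qed
  show ?thesis
  proof (cases "j < d")
    case True
    then show ?thesis by (rule coord)
  next
    case False
    \<comment> \<open>Here j = d. The last coordinate is not one of the variables, but on sum N it
      equals N minus the others.\<close>
    have "(\<lambda>x. real N * f x + (- 1) * (\<Sum>i<d. real (x i) * f x)) \<in> poly_space d N (Suc n)"
      using f by (intro poly_space_add poly_space_scale poly_space_sum coord poly_space_mono[OF f]) auto
    moreover have "real (x j) * f x = real N * f x + (- 1) * (\<Sum>i<d. real (x i) * f x)"
      if "x \<in> multi_index (Suc d) N" for x
    proof -
      have "real N = (\<Sum>i<d. real (x i)) + real (x j)"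
        using that False j by (auto simp: multi_index_def)
      then show ?thesis by (simp add: distrib_right sum_distrib_right)
    qed
    ultimately show ?thesis by (rule poly_space_cong)
  qed
qed

text \<open>Built one unit at a time: by \<open>mbinom_incr_index\<close>, \<gamma>_j times the
  product is x_j - (\<gamma>_j - 1) times the product with \<gamma>_j lowered by one.\<close>

lemma mbinom_in_poly_space:
  assumes "\<gamma> \<in> multi_index (Suc d) k"
  shows "mbinom d \<gamma> \<in> poly_space d N k"
  using assms
proof (induction k arbitrary: \<gamma>)
  case 0
  then have "mbinom d \<gamma> = (\<lambda>x. \<Prod>i<d. real (x i) ^ (\<lambda>_. 0) i)"
    by (auto simp: multi_index_0 mbinom_def)
  then show ?case using poly_space_monomial[of "\<lambda>_. 0" d 0 0 N] by (simp add: multi_index_0)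
next
  case (Suc k)
  obtain j where j: "j < Suc d" "\<gamma> j > 0" and \<gamma>': "\<gamma>(j := \<gamma> j - 1) \<in> multi_index (Suc d) k"
    using Suc.prems by (rule multi_index_Suc_obtain)
  let ?\<gamma> = "\<gamma>(j := \<gamma> j - 1)"
  have IH: "mbinom d ?\<gamma> \<in> poly_space d N k" by (rule Suc.IH[OF \<gamma>'])
  have "(\<lambda>x. (1 / real (\<gamma> j)) * (real (x j) * mbinom d ?\<gamma> x + (- real (\<gamma> j - 1)) * mbinom d ?\<gamma> x))
      \<in> poly_space d N (Suc k)"
    using j by (intro poly_space_add poly_space_scale poly_space_times_coord[OF IH] poly_space_mono[OF IH]) auto
  moreover have "mbinom d \<gamma> x
      = (1 / real (\<gamma> j)) * (real (x j) * mbinom d ?\<gamma> x + (- real (\<gamma> j - 1)) * mbinom d ?\<gamma> x)" for x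
  proof -
    have "real (\<gamma> j) * mbinom d \<gamma> x = (real (x j) - real (\<gamma> j - 1)) * mbinom d ?\<gamma> x"
      using mbinom_incr_index[of j d ?\<gamma> x] j by (simp del: of_nat_Suc)
    then show ?thesis using j(2) by (simp add: field_simps)
  qed
  ultimately show ?case by (rule poly_space_cong)
qed

lemma explicit_kernel_in_poly_space: "explicit_kernel d \<rho> N n x \<in> poly_space d N n"
proof -
  have "(\<lambda>y. \<Sum>k\<le>n. kernel_coeff N n k * (\<Sum>\<gamma>\<in>multi_index (Suc d) k.
      multi_fact d \<gamma> / rho_power d \<rho> \<gamma> * mbinom d \<gamma> x * mbinom d \<gamma> y)) \<in> poly_space d N n"
    by (intro poly_space_sum poly_space_scale poly_space_mono[OF mbinom_in_poly_space]) auto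
  then show ?thesis
    by (rule poly_space_cong) (simp add: explicit_kernel_def krawtchouk_F_mbinom)
qed

lemma explicit_kernel_in_krawtchouk_space:
  assumes "\<And>j. j \<le> d \<Longrightarrow> full_rho d \<rho> j \<noteq> 0" and "x \<in> multi_index (Suc d) N" and "n \<le> N"
  shows "explicit_kernel d \<rho> N n x \<in> krawtchouk_space d \<rho> N n"
proof -
  have "krawtchouk_inner d \<rho> N g (explicit_kernel d \<rho> N n x) = 0"
    if "g \<in> poly_space d N m" "m < n" for g m
    by (rule orthogonal_poly_space[OF explicit_kernel_orthogonal_mbinom[OF assms] that])
  then show ?thesis
    by (simp add: krawtchouk_space_def explicit_kernel_in_poly_space
        krawtchouk_inner_commute[of d \<rho> N "explicit_kernel d \<rho> N n x"])
qed

section \<open>Generating function, reproducing property and identification of the kernel\<close>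

text \<open>Write n = k + l and exchange the sums over the triangle; the inner sum over l is the
  binomial expansion of (1 - r)^(N - k).\<close>

lemma sum_explicit_kernel:
  "(\<Sum>n\<le>N. explicit_kernel d \<rho> N n x y * r ^ n)
     = (\<Sum>k\<le>N. fact (N - k) / fact N * krawtchouk_F d \<rho> k x y * r ^ k * (1 - r) ^ (N - k))"
proof -
  define F where "F k = krawtchouk_F d \<rho> k x y" for k
  define g where "g k l = (- 1) ^ l * real ((N - k) choose l) * (fact (N - k) / fact N) * F k * r ^ (k + l)"
    for k l
  have "(\<Sum>n\<le>N. explicit_kernel d \<rho> N n x y * r ^ n) = (\<Sum>n\<le>N. \<Sum>k\<le>n. g k (n - k))"
    by (simp add: explicit_kernel_def sum_distrib_right kernel_coeff_def g_def F_def)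
  also have "\<dots> = (\<Sum>(k, l)\<in>{(k, l). k + l \<le> N}. g k l)"
    by (rule sum.triangle_reindex_eq[symmetric])
  also have "{(k, l). k + l \<le> N} = Sigma {..N} (\<lambda>k. {..N - k})"
    by auto
  also have "(\<Sum>(k, l)\<in>Sigma {..N} (\<lambda>k. {..N - k}). g k l) = (\<Sum>k\<le>N. \<Sum>l\<le>N - k. g k l)"
    by (rule sum.Sigma[symmetric]) auto
  also have "\<dots> = (\<Sum>k\<le>N. fact (N - k) / fact N * F k * r ^ k * (1 - r) ^ (N - k))"
  proof (rule sum.cong[OF refl])
    fix k
    have "(1 - r) ^ (N - k) = (\<Sum>l\<le>N - k. real ((N - k) choose l) * (- r) ^ l)"
      using binomial_ring[of "- r" 1 "N - k"] by simp
    also have "fact (N - k) / fact N * F k * r ^ k * \<dots> = (\<Sum>l\<le>N - k. g k l)"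
      unfolding sum_distrib_left g_def
      by (intro sum.cong refl) (simp add: power_add power_minus[of r] mult_ac)
    finally show "(\<Sum>l\<le>N - k. g k l) = fact (N - k) / fact N * F k * r ^ k * (1 - r) ^ (N - k)" ..
  qed
  finally show ?thesis unfolding F_def .
qed

text \<open>Distinct multi-indices of equal sum have a coordinate with x_i < \<gamma>_i, whose
  binomial coefficient is 0.\<close>

lemma mbinom_delta:
  assumes "\<gamma> \<in> multi_index (Suc d) N" "x \<in> multi_index (Suc d) N"
  shows "mbinom d \<gamma> x = (if \<gamma> = x then 1 else 0)"
proof (cases "\<gamma> = x")
  case False
  have "\<exists>i\<le>d. x i < \<gamma> i"
  proof (rule ccontr)
    assume "\<not> (\<exists>i\<le>d. x i < \<gamma> i)"
    then have le: "\<gamma> i \<le> x i" if "i \<in> {..<Suc d}" for i using that by (auto simp: not_less)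
    have "(\<Sum>i<Suc d. \<gamma> i) = (\<Sum>i<Suc d. x i)"
      using assms unfolding multi_index_def by simp
    then have "\<gamma> i = x i" if "i < Suc d" for i
      using sum_mono_inv[of \<gamma> "{..<Suc d}" x i] le that by auto
    then have "\<gamma> i = x i" for i
      using assms by (cases "i < Suc d") (auto simp: multi_index_def)
    then show False using False by auto
  qed
  then show ?thesis using False by (auto simp: mbinom_def binomial_eq_0)
qed (simp add: mbinom_def)

text \<open>At r = 1, with 0^0 = 1, only k = N survives. By \<open>mbinom_delta\<close>,
  \<open>krawtchouk_F d \<rho> N x y\<close> divided by N! is concentrated at y = x, with value the
  inverse of the weight of x.\<close>

lemma sum_explicit_kernel_reproducing:
  assumes \<rho>: "\<And>j. j \<le> d \<Longrightarrow> full_rho d \<rho> j \<noteq> 0" and x: "x \<in> multi_index (Suc d) N"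
  shows "krawtchouk_inner d \<rho> N (\<lambda>y. \<Sum>n\<le>N. explicit_kernel d \<rho> N n x y) f = f x"
proof -
  let ?M = "multi_index (Suc d) N"
  have sum: "(\<Sum>n\<le>N. explicit_kernel d \<rho> N n x y)
      = (if y = x then multi_fact d x / rho_power d \<rho> x / fact N else 0)" if y: "y \<in> ?M" for y
  proof -
    have "(\<Sum>n\<le>N. explicit_kernel d \<rho> N n x y)
        = (\<Sum>k\<le>N. fact (N - k) / fact N * krawtchouk_F d \<rho> k x y * 0 ^ (N - k))"
      using sum_explicit_kernel[of d \<rho> N x y 1] by simp
    also have "\<dots> = (\<Sum>k\<le>N. if k = N then krawtchouk_F d \<rho> N x y / fact N else 0)"
      by (intro sum.cong refl) (auto simp: power_0_left)
    also have "\<dots> = krawtchouk_F d \<rho> N x y / fact N"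
      by simp
    also have "krawtchouk_F d \<rho> N x y
        = (\<Sum>\<gamma>\<in>?M. if \<gamma> = x then multi_fact d x / rho_power d \<rho> x * mbinom d x y else 0)"
      unfolding krawtchouk_F_mbinom by (intro sum.cong refl) (simp add: mbinom_delta x)
    finally show ?thesis using x y by (auto simp: finite_multi_index mbinom_delta)
  qed
  have "rho_power d \<rho> x \<noteq> 0" using \<rho> by (simp add: rho_power_def)
  moreover have "multi_fact d x \<noteq> 0" by (simp add: multi_fact_def)
  moreover have "krawtchouk_inner d \<rho> N (\<lambda>y. \<Sum>n\<le>N. explicit_kernel d \<rho> N n x y) f
      = fact N * (\<Sum>y\<in>?M. if y = x then multi_fact d x / rho_power d \<rho> x / fact N * f x *
          (rho_power d \<rho> x / multi_fact d x) else 0)"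
    unfolding krawtchouk_inner_def
    by (intro arg_cong2[where f = "(*)"] sum.cong refl) (simp add: sum)
  ultimately show ?thesis using x by (simp add: finite_multi_index)
qed

text \<open>Split the full reproducing identity by degree m. For m < n, \<open>f\<close> is
  orthogonal to the kernel, which has degree at most m; for m > n, the kernel is orthogonal to
  \<open>f\<close>. Only m = n remains.\<close>

lemma explicit_kernel_reproducing:
  assumes \<rho>: "\<And>j. j \<le> d \<Longrightarrow> full_rho d \<rho> j \<noteq> 0" and x: "x \<in> multi_index (Suc d) N"
    and n: "n \<le> N" and f: "f \<in> krawtchouk_space d \<rho> N n"
  shows "krawtchouk_inner d \<rho> N (explicit_kernel d \<rho> N n x) f = f x"
proof -
  let ?I = "\<lambda>m. krawtchouk_inner d \<rho> N (explicit_kernel d \<rho> N m x) f"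
  have other: "?I m = 0" if "m \<le> N" "m \<noteq> n" for m
  proof (cases "m < n")
    case True
    then show ?thesis using f explicit_kernel_in_poly_space
      by (auto simp: krawtchouk_space_def krawtchouk_inner_commute[of d \<rho> N _ f])
  next
    case False
    then have "n < m" using that(2) by simp
    then show ?thesis
      using f explicit_kernel_in_krawtchouk_space[OF \<rho> x that(1)]
      by (auto simp: krawtchouk_space_def)
  qed
  have "f x = (\<Sum>m\<le>N. ?I m)"
    using sum_explicit_kernel_reproducing[OF \<rho> x] by (simp only: krawtchouk_inner_sum)
  also have "\<dots> = (\<Sum>m\<le>N. if m = n then ?I n else 0)"
    using other by (intro sum.cong) auto
  finally show ?thesis using n by simp
qed

lemma krawtchouk_kernel_eq_explicit:
  assumes \<rho>: "\<forall>i<d. 0 < \<rho> i" "(\<Sum>i<d. \<rho> i) < 1" and n: "n \<le> N"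
    and x: "x \<in> multi_index (Suc d) N" and y: "y \<in> multi_index (Suc d) N"
  shows "krawtchouk_kernel d \<rho> N n x y = explicit_kernel d \<rho> N n x y"
proof -
  let ?M = "multi_index (Suc d) N"
  let ?V = "krawtchouk_space d \<rho> N n"
  \<comment> \<open>\<open>krawtchouk_kernel\<close> is fixed as a total function by vanishing off
    the multi-indices of sum N, so the explicit kernel is cut off in the same way before uniqueness
    is applied.\<close>
  define P where "P x y = (if x \<in> ?M \<and> y \<in> ?M then explicit_kernel d \<rho> N n x y else 0)" for x y
  have nz: "full_rho d \<rho> j \<noteq> 0" if "j \<le> d" for j
    using \<rho> that by (auto simp: full_rho_def)
  have V: "explicit_kernel d \<rho> N n x \<in> ?V" if "x \<in> ?M" for x
    by (rule explicit_kernel_in_krawtchouk_space[OF nz that n])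
  have "is_reproducing_kernel d \<rho> N n P"
    unfolding is_reproducing_kernel_def
  proof (intro conjI ballI)
    fix x assume x: "x \<in> ?M"
    show "(\<lambda>y. P x y) \<in> ?V"
      by (rule krawtchouk_space_cong[OF V[OF x]]) (simp add: P_def x)
    show "(\<lambda>y. P y x) \<in> ?V"
      by (rule krawtchouk_space_cong[OF V[OF x]]) (simp add: P_def x explicit_kernel_commute[of d \<rho> N n _ x])
    fix Q assume Q: "Q \<in> ?V"
    have "krawtchouk_inner d \<rho> N (P x) Q = krawtchouk_inner d \<rho> N (explicit_kernel d \<rho> N n x) Q"
      by (rule krawtchouk_inner_cong) (simp_all add: P_def x)
    then show "krawtchouk_inner d \<rho> N (P x) Q = Q x"
      using explicit_kernel_reproducing[OF nz x n Q] by simp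
  qed
  then have "krawtchouk_kernel d \<rho> N n = P"
    unfolding krawtchouk_kernel_def
    by (intro the1_equality krawtchouk_kernel_ex1[OF \<rho>]) (auto simp: P_def)
  then show ?thesis using x y by (simp add: P_def)
qed

section \<open>Nonnegativity and the final formula\<close>

lemma krawtchouk_F_nonneg:
  assumes "\<And>j. j \<le> d \<Longrightarrow> full_rho d \<rho> j > 0"
  shows "krawtchouk_F d \<rho> k x y \<ge> 0"
proof -
  have "rho_power d \<rho> \<gamma> > 0" for \<gamma>
    using assms by (auto simp: rho_power_def intro!: prod_pos)
  moreover have "multi_fact d \<gamma> > 0" "mbinom d \<gamma> z \<ge> 0" for \<gamma> z
    by (auto simp: multi_fact_def mbinom_def intro!: prod_pos prod_nonneg)
  ultimately show ?thesis
    unfolding krawtchouk_F_mbinom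
    by (intro sum_nonneg mult_nonneg_nonneg divide_nonneg_pos) (auto simp: less_imp_le)
qed

text \<open>Translates the normalization in \<open>kernel_coeff\<close> into the Pochhammer quotient
  of the claimed formula.\<close>

lemma inverse_pochhammer_minus:
  assumes "k \<le> N"
  shows "(- 1) ^ k / pochhammer (- real N) k = fact (N - k) / fact N"
proof -
  have "pochhammer (- real N) k = (- 1) ^ k * (fact k * real (N choose k))"
    by (simp add: binomial_gbinomial gbinomial_pochhammer flip: power_mult_distrib mult.assoc)
  also have "fact k * real (N choose k) = fact N / fact (N - k)"
    using assms by (simp add: binomial_fact)
  finally show ?thesis by simp
qed

theorem theorem5p5:
  fixes d N :: nat and \<rho> :: "nat \<Rightarrow> real"
  assumes "d \<ge> 1" and "\<forall>i<d. 0 < \<rho> i \<and> \<rho> i < 1" and "(\<Sum>i<d. \<rho> i) < 1" and "N > 0"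
  shows "\<forall>x\<in>multi_index (Suc d) N. \<forall>y\<in>multi_index (Suc d) N. \<forall>r::real. 0 \<le> r \<and> r \<le> 1 \<longrightarrow>
      poisson_kernel d \<rho> N r x y =
        (\<Sum>k\<le>N. (- 1) ^ k / pochhammer (- real N) k * krawtchouk_F d \<rho> k x y * r ^ k * (1 - r) ^ (N - k))
      \<and> 0 \<le> poisson_kernel d \<rho> N r x y"
proof (intro ballI allI impI)
  fix x y and r :: real
  assume x: "x \<in> multi_index (Suc d) N" and y: "y \<in> multi_index (Suc d) N" and r: "0 \<le> r \<and> r \<le> 1"
  have \<rho>: "\<forall>i<d. 0 < \<rho> i" using assms(2) by blast
  then have pos: "full_rho d \<rho> j > 0" if "j \<le> d" for j
    using assms(3) that by (auto simp: full_rho_def)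
  have "poisson_kernel d \<rho> N r x y = (\<Sum>n\<le>N. explicit_kernel d \<rho> N n x y * r ^ n)"
    unfolding poisson_kernel_def
    by (intro sum.cong refl) (simp add: krawtchouk_kernel_eq_explicit[OF \<rho> assms(3) _ x y])
  also have "\<dots> = (\<Sum>k\<le>N. fact (N - k) / fact N * krawtchouk_F d \<rho> k x y * r ^ k * (1 - r) ^ (N - k))"
    by (rule sum_explicit_kernel)
  finally have eq: "poisson_kernel d \<rho> N r x y
      = (\<Sum>k\<le>N. fact (N - k) / fact N * krawtchouk_F d \<rho> k x y * r ^ k * (1 - r) ^ (N - k))" .
  moreover have "\<dots> = (\<Sum>k\<le>N. (- 1) ^ k / pochhammer (- real N) k * krawtchouk_F d \<rho> k x y
      * r ^ k * (1 - r) ^ (N - k))"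
    by (intro sum.cong refl) (simp only: inverse_pochhammer_minus atMost_iff)
  \<comment> \<open>Back in the form with (N - k)!/N! the signs are gone, and every summand is a
    product of nonnegative factors.\<close>
  moreover have "\<dots> \<ge> 0"
    unfolding calculation(2)[symmetric]
    using r by (intro sum_nonneg mult_nonneg_nonneg krawtchouk_F_nonneg pos) auto
  ultimately show "poisson_kernel d \<rho> N r x y =
        (\<Sum>k\<le>N. (- 1) ^ k / pochhammer (- real N) k * krawtchouk_F d \<rho> k x y * r ^ k * (1 - r) ^ (N - k))
      \<and> 0 \<le> poisson_kernel d \<rho> N r x y"
    by simp
qed

end
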